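(* Consider the mean-field singular game of two competing companies described in the context. Assume that the interval $[0,T]$ can be divided into $0=t_0<t_1<\cdots<t_n=T$ such that on each interval $[t_k,t_{k+1})$ the signs of $\pi(t)+h_1(t)$ and $\pi(t)+h_2(t)$ remain unchanged. Then the solution $\xi_1$, $\xi_2$ of the coupled reflected Skorohod problem characterizing the Nash equilibrium (stated in the context) can be found recursively on each interval $[t_k,t_{k+1}]$, $k=0,1,\dots,n-1$, as follows. On $[t_k,t_{k+1}]$: (i) If both $\pi(t)+h_1(t)<0$ and $\pi(t)+h_2(t)<0$ hold, then do nothing (both $\xi_1$ and $\xi_2$ are kept unchanged). (ii) If $\pi(t)+h_1(t)<0$ but $\pi(t)+h_2(t)\ge0$, then $$\xi_1(t)=\xi_1(t_k),\qquad\xi_2(t)=\sup_{t_k\le s\le t}(X(s)-\xi_1(t_k))^+,\qquad t_k\le t\le t_{k+1}.$$ If $\pi(t)+h_1(t)\ge0$ but $\pi(t)+h_2(t)<0$, then $$\xi_2(t)=\xi_2(t_k),\qquad\xi_1(t)=\sup_{t_k\le s\le t}(X(s)-\xi_2(t_k))^+,\qquad t_k\le t\le t_{k+1}.$$ (iii) If both $\pi(t)+h_1(t)\ge0$ and $\pi(t)+h_2(t)\ge0$ hold, then $\xi_1$ and $\xi_2$ can be any nondecreasing processes such that $$\xi_1(t)+\xi_2(t)=\sup_{t_k\le s\le t}X(s)^+,\qquad t_k\le t\le t_{k+1}.$$ In particular, in this case the Nash equilibrium is not unique.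
   Context: $B(t)$ is a Brownian motion on a filtered probability space $(\Omega,\mathcal{F},\mathbb{F}=\{\mathcal{F}_t\}_{t\ge0},P)$ satisfying the usual conditions. The demand $X(t)$ for a product satisfies the mean-field SDE $dX(t)=E[X(t)]b(t)dt+X(t)\sigma(t)dB(t)$, $X(0)=x>0$. Two companies have production rate capacities $\xi_1,\xi_2$, where $\xi_i\in\mathcal{A}_i$, the family of admissible controls of company $i$ (nondecreasing adapted processes). The expected profit of company $i$ is $$J_i(\xi_1,\xi_2)=E\left[\int_0^T\pi(t)\min(X(t),\xi_1(t)+\xi_2(t))dt+\int_0^Th_i(t)d\xi_i(t)\right],$$ where $\pi(t)>0$ is the price per unit sold and $h_i(t)<0$ is the production cost per unit (with sign) for company $i$. A Nash equilibrium is a pair $(\xi_1^*,\xi_2^* )\in\mathcal{A}_1\times\mathcal{A}_2$ with $\sup_{\xi_1\in\mathcal{A}_1}J_1(\xi_1,\xi_2^* )=J_1(\xi_1^*,\xi_2^* )$ and $\sup_{\xi_2\in\mathcal{A}_2}J_2(\xi_1^*,\xi_2)=J_2(\xi_1^*,\xi_2^* )$. In the paper, the Nash equilibrium is found by solving the coupled reflected Skorohod problem (with $\chi$ denoting indicator functions) $$\xi_1(t)\ge(X(t)-\xi_2(t))\chi_{[0,\infty)}(\pi(t)+h_1(t)),\quad\left[\xi_1(t)-(X(t)-\xi_2(t))\chi_{[0,\infty)}(\pi(t)+h_1(t))\right]\xi_1(dt)=0,$$ $$\xi_2(t)\ge(X(t)-\xi_1(t))\chi_{[0,\infty)}(\pi(t)+h_2(t)),\quad\left[\xi_2(t)-(X(t)-\xi_1(t))\chi_{[0,\infty)}(\pi(t)+h_2(t))\right]\xi_2(dt)=0.$$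 In this problem "do nothing" means that the capacity $\xi_i$ is not increased.
   Formalization: Formulas hold on [t_k,t_{k+1}) with ξ_i(t_k) the left limit; suprema are floored at installed capacity; for k≥1 non-uniqueness needs demand above installed capacity with positive probability; for Nash equilibria it assumes every Skorohod solution is one. *)

theory Defs
  imports "HOL-Probability.Probability"
begin

text \<open>
  Processes are functions of time and outcome. The library locale \<^locale>\<open>filtration\<close> is used
  with index type \<^typ>\<open>real\<close>; only the sigma-algebras at times \<open>t \<ge> 0\<close> matter (a filtration
  on the half line is extended by \<open>F t = F 0\<close> for \<open>t < 0\<close>).
\<close>

definition usual_conditions :: "'a measure \<Rightarrow> (real \<Rightarrow> 'a measure) \<Rightarrow> bool" where
  "usual_conditions M F \<longleftrightarrow>
     filtration (space M) F \<and>
     (\<forall>t\<ge>0. sets (F t) \<subseteq> sets M) \<and>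
     (\<forall>N\<in>null_sets M. \<forall>A\<subseteq>N. A \<in> sets (F 0)) \<and>
     (\<forall>t\<ge>0. sets (F t) = (\<Inter>s\<in>{t<..}. sets (F s)))"

definition brownian_motion ::
    "'a measure \<Rightarrow> (real \<Rightarrow> 'a measure) \<Rightarrow> (real \<Rightarrow> 'a \<Rightarrow> real) \<Rightarrow> bool" where
  "brownian_motion M F B \<longleftrightarrow>
     (\<forall>t\<ge>0. B t \<in> borel_measurable (F t)) \<and>
     (AE \<omega> in M. B 0 \<omega> = 0) \<and>
     (\<forall>\<omega>\<in>space M. continuous_on {0..} (\<lambda>t. B t \<omega>)) \<and>
     (\<forall>s\<ge>0. \<forall>t>s.
        distributed M lborel (\<lambda>\<omega>. B t \<omega> - B s \<omega>) (normal_density 0 (sqrt (t - s))) \<and>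
        prob_space.indep_set M (sets (F s))
          {(\<lambda>\<omega>. B t \<omega> - B s \<omega>) -` A \<inter> space M | A. A \<in> sets borel})"

definition measurable_adapted ::
    "'a measure \<Rightarrow> (real \<Rightarrow> 'a measure) \<Rightarrow> real \<Rightarrow> (real \<Rightarrow> 'a \<Rightarrow> real) \<Rightarrow> bool" where
  "measurable_adapted M F T Y \<longleftrightarrow>
     (\<lambda>(t, \<omega>). Y t \<omega>) \<in> borel_measurable (restrict_space borel {0..T} \<Otimes>\<^sub>M M) \<and>
     (\<forall>t\<in>{0..T}. Y t \<in> borel_measurable (F t))"

subsection \<open>The Ito integral of square integrable adapted integrands\<close>

text \<open>
  The triple \<open>(m, s, e)\<close> encodes the elementary integrand
  \<open>\<Sum>j<m. e j \<omega> * 1_[s j, s (j+1))(t)\<close>.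
\<close>

definition elementary ::
    "'a measure \<Rightarrow> (real \<Rightarrow> 'a measure) \<Rightarrow> nat \<Rightarrow> (nat \<Rightarrow> real) \<Rightarrow> (nat \<Rightarrow> 'a \<Rightarrow> real) \<Rightarrow> bool" where
  "elementary M F m s e \<longleftrightarrow>
     0 \<le> s 0 \<and> (\<forall>j<m. s j < s (Suc j)) \<and>
     (\<forall>j<m. e j \<in> borel_measurable (F (s j)) \<and> integrable M (\<lambda>\<omega>. (e j \<omega>)\<^sup>2))"

definition elementary_process ::
    "nat \<Rightarrow> (nat \<Rightarrow> real) \<Rightarrow> (nat \<Rightarrow> 'a \<Rightarrow> real) \<Rightarrow> real \<Rightarrow> 'a \<Rightarrow> real" where
  "elementary_process m s e t \<omega> = (\<Sum>j<m. e j \<omega> * indicator {s j..<s (Suc j)} t)"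

definition elementary_integral ::
    "(real \<Rightarrow> 'a \<Rightarrow> real) \<Rightarrow> nat \<Rightarrow> (nat \<Rightarrow> real) \<Rightarrow> (nat \<Rightarrow> 'a \<Rightarrow> real) \<Rightarrow> real \<Rightarrow> 'a \<Rightarrow> real" where
  "elementary_integral B m s e t \<omega> =
     (\<Sum>j<m. e j \<omega> * (B (min t (s (Suc j))) \<omega> - B (min t (s j)) \<omega>))"

text \<open>\<open>I t\<close> is the L2-limit of the integrals over \<open>[0, t]\<close> of elementary approximations of \<open>H\<close>.\<close>

definition ito_integral ::
    "'a measure \<Rightarrow> (real \<Rightarrow> 'a measure) \<Rightarrow> (real \<Rightarrow> 'a \<Rightarrow> real) \<Rightarrow> real \<Rightarrow>
     (real \<Rightarrow> 'a \<Rightarrow> real) \<Rightarrow> (real \<Rightarrow> 'a \<Rightarrow> real) \<Rightarrow> bool" where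
  "ito_integral M F B T H I \<longleftrightarrow>
     measurable_adapted M F T H \<and>
     (\<integral>\<^sup>+\<omega>. (\<integral>\<^sup>+t\<in>{0..T}. ennreal ((H t \<omega>)\<^sup>2) \<partial>lborel) \<partial>M) < \<infinity> \<and>
     (\<forall>t\<in>{0..T}. I t \<in> borel_measurable M) \<and>
     (\<exists>m s e.
        (\<forall>n. elementary M F (m n) (s n) (e n)) \<and>
        (\<lambda>n. \<integral>\<^sup>+\<omega>. (\<integral>\<^sup>+t\<in>{0..T}.
            ennreal ((elementary_process (m n) (s n) (e n) t \<omega> - H t \<omega>)\<^sup>2) \<partial>lborel) \<partial>M)
          \<longlonglongrightarrow> 0 \<and>
        (\<forall>t\<in>{0..T}.
           (\<lambda>n. \<integral>\<^sup>+\<omega>. ennreal ((elementary_integral B (m n) (s n) (e n) t \<omega> - I t \<omega>)\<^sup>2) \<partial>M)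
             \<longlonglongrightarrow> 0))"

definition mean_field_sde ::
    "'a measure \<Rightarrow> (real \<Rightarrow> 'a measure) \<Rightarrow> (real \<Rightarrow> 'a \<Rightarrow> real) \<Rightarrow> real \<Rightarrow>
     (real \<Rightarrow> 'a \<Rightarrow> real) \<Rightarrow> (real \<Rightarrow> 'a \<Rightarrow> real) \<Rightarrow> real \<Rightarrow> (real \<Rightarrow> 'a \<Rightarrow> real) \<Rightarrow> bool" where
  "mean_field_sde M F B T b \<sigma> x X \<longleftrightarrow>
     (\<forall>t\<in>{0..T}. X t \<in> borel_measurable (F t) \<and> integrable M (X t)) \<and>
     (\<forall>\<omega>\<in>space M. continuous_on {0..T} (\<lambda>t. X t \<omega>)) \<and>
     (AE \<omega> in M. X 0 \<omega> = x) \<and>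
     (AE \<omega> in M. set_integrable lborel {0..T} (\<lambda>s. integral\<^sup>L M (X s) * b s \<omega>)) \<and>
     (\<exists>I. ito_integral M F B T (\<lambda>t \<omega>. X t \<omega> * \<sigma> t \<omega>) I \<and>
        (\<forall>t\<in>{0..T}. AE \<omega> in M.
           X t \<omega> = x + (LINT s:{0..t}|lborel. integral\<^sup>L M (X s) * b s \<omega>) + I t \<omega>))"

subsection \<open>Controls, profits and Nash equilibria\<close>

text \<open>
  As usual for singular controls, capacities are right continuous and \<open>\<xi>(0-) = 0\<close>, so that an
  initial value \<open>\<xi>(0) > 0\<close> is a jump at time 0 and is charged by the measure \<open>\<xi>(dt)\<close>.
\<close>

definition admissible ::
    "'a measure \<Rightarrow> (real \<Rightarrow> 'a measure) \<Rightarrow> (real \<Rightarrow> 'a \<Rightarrow> real) set" where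
  "admissible M F = {\<xi>.
     (\<forall>t\<ge>0. \<xi> t \<in> borel_measurable (F t)) \<and>
     (\<forall>\<omega>\<in>space M.
        0 \<le> \<xi> 0 \<omega> \<and> mono_on {0..} (\<lambda>t. \<xi> t \<omega>) \<and>
        (\<forall>t\<ge>0. continuous (at_right t) (\<lambda>s. \<xi> s \<omega>)))}"

definition zero_before :: "(real \<Rightarrow> real) \<Rightarrow> real \<Rightarrow> real" where
  "zero_before f t = (if t < 0 then 0 else f t)"

definition stieltjes :: "(real \<Rightarrow> real) \<Rightarrow> real measure" where
  "stieltjes f = interval_measure (zero_before f)"

text \<open>The capacity \<open>f(t-)\<close> built strictly before time \<open>t\<close>.\<close>

definition left_value :: "(real \<Rightarrow> real) \<Rightarrow> real \<Rightarrow> real" where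
  "left_value f t = Lim (at_left t) (zero_before f)"

text \<open>
  The expectation is taken in the extended sense, as expected gains minus expected losses, so that
  a control of infinite expected cost has profit \<open>-\<infinity>\<close> (the costs \<open>h\<close> are negative).
  The Stieltjes integral extends over \<open>[0, T)\<close>: capacity installed at time \<open>T\<close> cannot
  influence the sales, and \<open>\<xi>(T)\<close> plays no role in the game.
\<close>

definition expected_profit ::
    "'a measure \<Rightarrow> real \<Rightarrow> (real \<Rightarrow> 'a \<Rightarrow> real) \<Rightarrow> (real \<Rightarrow> 'a \<Rightarrow> real) \<Rightarrow> (real \<Rightarrow> 'a \<Rightarrow> real) \<Rightarrow>
     (real \<Rightarrow> 'a \<Rightarrow> real) \<Rightarrow> (real \<Rightarrow> 'a \<Rightarrow> real) \<Rightarrow> ereal" where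
  "expected_profit M T \<pi> h X own other =
     enn2ereal (\<integral>\<^sup>+\<omega>.
        (\<integral>\<^sup>+t\<in>{0..T}. ennreal (\<pi> t \<omega> * min (X t \<omega>) (own t \<omega> + other t \<omega>)) \<partial>lborel) \<partial>M)
     - enn2ereal (\<integral>\<^sup>+\<omega>.
        (\<integral>\<^sup>+t\<in>{0..T}. ennreal (- (\<pi> t \<omega> * min (X t \<omega>) (own t \<omega> + other t \<omega>))) \<partial>lborel)
        + (\<integral>\<^sup>+t\<in>{0..<T}. ennreal (- h t \<omega>) \<partial>stieltjes (\<lambda>t. own t \<omega>)) \<partial>M)"

definition nash_equilibrium ::
    "'c set \<Rightarrow> 'd set \<Rightarrow> ('c \<Rightarrow> 'd \<Rightarrow> ereal) \<Rightarrow> ('c \<Rightarrow> 'd \<Rightarrow> ereal) \<Rightarrow> 'c \<Rightarrow> 'd \<Rightarrow> bool" where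
  "nash_equilibrium A1 A2 J1 J2 \<xi>1 \<xi>2 \<longleftrightarrow>
     \<xi>1 \<in> A1 \<and> \<xi>2 \<in> A2 \<and>
     (SUP \<eta>\<in>A1. J1 \<eta> \<xi>2) = J1 \<xi>1 \<xi>2 \<and>
     (SUP \<eta>\<in>A2. J2 \<xi>1 \<eta>) = J2 \<xi>1 \<xi>2"

definition game_equilibrium ::
    "'a measure \<Rightarrow> (real \<Rightarrow> 'a measure) \<Rightarrow> real \<Rightarrow> (real \<Rightarrow> 'a \<Rightarrow> real) \<Rightarrow>
     (real \<Rightarrow> 'a \<Rightarrow> real) \<Rightarrow> (real \<Rightarrow> 'a \<Rightarrow> real) \<Rightarrow> (real \<Rightarrow> 'a \<Rightarrow> real) \<Rightarrow>
     (real \<Rightarrow> 'a \<Rightarrow> real) \<Rightarrow> (real \<Rightarrow> 'a \<Rightarrow> real) \<Rightarrow> bool" where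
  "game_equilibrium M F T \<pi> h1 h2 X \<xi>1 \<xi>2 \<longleftrightarrow>
     nash_equilibrium (admissible M F) (admissible M F)
       (\<lambda>\<xi> \<eta>. expected_profit M T \<pi> h1 X \<xi> \<eta>)
       (\<lambda>\<xi> \<eta>. expected_profit M T \<pi> h2 X \<eta> \<xi>) \<xi>1 \<xi>2"

subsection \<open>The coupled reflected Skorohod problem\<close>

text \<open>
  The equation \<open>[\<dots>] \<xi>(dt) = 0\<close> between measures on \<open>[0, T)\<close> is expressed by the vanishing of the
  total mass, the density \<open>[\<dots>]\<close> being nonnegative there.
\<close>

definition reflected_at ::
    "real \<Rightarrow> (real \<Rightarrow> real) \<Rightarrow> (real \<Rightarrow> real) \<Rightarrow> bool" where
  "reflected_at T Y u \<longleftrightarrow>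
     (\<forall>t\<in>{0..<T}. Y t \<le> u t) \<and>
     (\<integral>\<^sup>+t\<in>{0..<T}. ennreal (u t - Y t) \<partial>stieltjes u) = 0"

definition skorohod_solution ::
    "'a measure \<Rightarrow> (real \<Rightarrow> 'a measure) \<Rightarrow> real \<Rightarrow> (real \<Rightarrow> 'a \<Rightarrow> real) \<Rightarrow>
     (real \<Rightarrow> 'a \<Rightarrow> real) \<Rightarrow> (real \<Rightarrow> 'a \<Rightarrow> real) \<Rightarrow> (real \<Rightarrow> 'a \<Rightarrow> real) \<Rightarrow>
     (real \<Rightarrow> 'a \<Rightarrow> real) \<Rightarrow> (real \<Rightarrow> 'a \<Rightarrow> real) \<Rightarrow> bool" where
  "skorohod_solution M F T \<pi> h1 h2 X \<xi>1 \<xi>2 \<longleftrightarrow>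
     \<xi>1 \<in> admissible M F \<and> \<xi>2 \<in> admissible M F \<and>
     (AE \<omega> in M.
        reflected_at T
          (\<lambda>t. (X t \<omega> - \<xi>2 t \<omega>) * indicator {0..} (\<pi> t \<omega> + h1 t \<omega>)) (\<lambda>t. \<xi>1 t \<omega>) \<and>
        reflected_at T
          (\<lambda>t. (X t \<omega> - \<xi>1 t \<omega>) * indicator {0..} (\<pi> t \<omega> + h2 t \<omega>)) (\<lambda>t. \<xi>2 t \<omega>))"

subsection \<open>The recursion on an interval of constant signs\<close>

text \<open>
  Pathwise rules on \<open>[a, b)\<close>, given the capacities \<open>p\<close>, \<open>q\<close> of the two companies at the end of
  the preceding interval, and the values \<open>g1\<close>, \<open>g2\<close> of \<open>\<pi> + h1\<close>, \<open>\<pi> + h2\<close>. The rules are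
  stated on half-open intervals because at \<open>b\<close> the signs may change and the capacity then jumps;
  by continuity the values at the right end point are the left limits there.
  Monotonicity of \<open>u\<close>, \<open>v\<close> is not repeated here: it is part of admissibility.
\<close>

definition recursion_rule ::
    "(real \<Rightarrow> real) \<Rightarrow> (real \<Rightarrow> real) \<Rightarrow> (real \<Rightarrow> real) \<Rightarrow> real \<Rightarrow> real \<Rightarrow> real \<Rightarrow> real \<Rightarrow>
     (real \<Rightarrow> real) \<Rightarrow> (real \<Rightarrow> real) \<Rightarrow> bool" where
  "recursion_rule X g1 g2 a b p q u v \<longleftrightarrow>
     ((\<forall>t\<in>{a..<b}. g1 t < 0 \<and> g2 t < 0) \<longrightarrow> (\<forall>t\<in>{a..<b}. u t = p \<and> v t = q)) \<and>
     ((\<forall>t\<in>{a..<b}. g1 t < 0 \<and> 0 \<le> g2 t) \<longrightarrow>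
        (\<forall>t\<in>{a..<b}. u t = p \<and> v t = (SUP s\<in>{a..t}. max 0 (X s - p)))) \<and>
     ((\<forall>t\<in>{a..<b}. 0 \<le> g1 t \<and> g2 t < 0) \<longrightarrow>
        (\<forall>t\<in>{a..<b}. v t = q \<and> u t = (SUP s\<in>{a..t}. max 0 (X s - q)))) \<and>
     ((\<forall>t\<in>{a..<b}. 0 \<le> g1 t \<and> 0 \<le> g2 t) \<longrightarrow>
        (\<forall>t\<in>{a..<b}. u t + v t = (SUP s\<in>{a..t}. max 0 (X s))))"

text \<open>
  The running suprema above start afresh at \<open>a\<close> and may lie below the capacity that is already
  installed, whereas capacities are nondecreasing. The following rule takes the installed capacity
  as a floor. It agrees with the previous one whenever the latter does not prescribe a decrease,
  in particular on the first interval, where \<open>p = q = 0\<close>.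
\<close>

definition floored_recursion_rule ::
    "(real \<Rightarrow> real) \<Rightarrow> (real \<Rightarrow> real) \<Rightarrow> (real \<Rightarrow> real) \<Rightarrow> real \<Rightarrow> real \<Rightarrow> real \<Rightarrow> real \<Rightarrow>
     (real \<Rightarrow> real) \<Rightarrow> (real \<Rightarrow> real) \<Rightarrow> bool" where
  "floored_recursion_rule X g1 g2 a b p q u v \<longleftrightarrow>
     ((\<forall>t\<in>{a..<b}. g1 t < 0 \<and> g2 t < 0) \<longrightarrow> (\<forall>t\<in>{a..<b}. u t = p \<and> v t = q)) \<and>
     ((\<forall>t\<in>{a..<b}. g1 t < 0 \<and> 0 \<le> g2 t) \<longrightarrow>
        (\<forall>t\<in>{a..<b}. u t = p \<and> v t = max q (SUP s\<in>{a..t}. max 0 (X s - p)))) \<and>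
     ((\<forall>t\<in>{a..<b}. 0 \<le> g1 t \<and> g2 t < 0) \<longrightarrow>
        (\<forall>t\<in>{a..<b}. v t = q \<and> u t = max p (SUP s\<in>{a..t}. max 0 (X s - q)))) \<and>
     ((\<forall>t\<in>{a..<b}. 0 \<le> g1 t \<and> 0 \<le> g2 t) \<longrightarrow>
        (\<forall>t\<in>{a..<b}. u t + v t = max (p + q) (SUP s\<in>{a..t}. max 0 (X s))))"

definition follows ::
    "((real \<Rightarrow> real) \<Rightarrow> (real \<Rightarrow> real) \<Rightarrow> (real \<Rightarrow> real) \<Rightarrow> real \<Rightarrow> real \<Rightarrow> real \<Rightarrow> real \<Rightarrow>
      (real \<Rightarrow> real) \<Rightarrow> (real \<Rightarrow> real) \<Rightarrow> bool) \<Rightarrow>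
     'a measure \<Rightarrow> nat \<Rightarrow> (nat \<Rightarrow> real) \<Rightarrow> (real \<Rightarrow> 'a \<Rightarrow> real) \<Rightarrow>
     (real \<Rightarrow> 'a \<Rightarrow> real) \<Rightarrow> (real \<Rightarrow> 'a \<Rightarrow> real) \<Rightarrow> (real \<Rightarrow> 'a \<Rightarrow> real) \<Rightarrow>
     (real \<Rightarrow> 'a \<Rightarrow> real) \<Rightarrow> (real \<Rightarrow> 'a \<Rightarrow> real) \<Rightarrow> bool" where
  "follows rule M n \<tau> \<pi> h1 h2 X \<xi>1 \<xi>2 \<longleftrightarrow>
     (AE \<omega> in M. \<forall>k<n.
        rule (\<lambda>t. X t \<omega>) (\<lambda>t. \<pi> t \<omega> + h1 t \<omega>) (\<lambda>t. \<pi> t \<omega> + h2 t \<omega>) (\<tau> k) (\<tau> (Suc k))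
          (left_value (\<lambda>t. \<xi>1 t \<omega>) (\<tau> k)) (left_value (\<lambda>t. \<xi>2 t \<omega>) (\<tau> k))
          (\<lambda>t. \<xi>1 t \<omega>) (\<lambda>t. \<xi>2 t \<omega>))"

definition same_on ::
    "'a measure \<Rightarrow> real \<Rightarrow> (real \<Rightarrow> 'a \<Rightarrow> real) \<Rightarrow> (real \<Rightarrow> 'a \<Rightarrow> real) \<Rightarrow> bool" where
  "same_on M T \<xi> \<eta> \<longleftrightarrow> (AE \<omega> in M. \<forall>t\<in>{0..<T}. \<xi> t \<omega> = \<eta> t \<omega>)"

end

theory Submission
  imports Defs
begin

text \<open>
  The statement reduces to a pathwise fact. On a time interval \<open>[a, b)\<close> on which the signs of
  \<open>\<pi> + h1\<close> and \<open>\<pi> + h2\<close> are constant, the coupled reflected Skorohod problem is the classical one: a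
  nondecreasing path that stays above a continuous obstacle and grows only when it touches the
  obstacle is the running maximum of the obstacle, floored at the value installed before \<open>a\<close>.
  A company with negative margin faces the obstacle 0 and therefore never builds; its competitor,
  if its own margin is nonnegative, then faces the demand minus a constant. If both margins are nonnegative, the two conditions have
  the same density \<open>\<xi>1 + \<xi>2 - X\<close>, and only the sum is determined. All these cases are instances
  of a Skorohod lemma for two controllers who jointly keep \<open>u + v\<close> above an obstacle
  (\<open>reflected_pair_iff_running_max\<close>); cutting \<open>[0, T)\<close> at the partition points gives the equivalence of
  the Skorohod problem with the floored recursion (\<open>reflected_at_iff_floored_rule\<close>). The recursion
  without floor implies the one with floor because capacities are nondecreasing.

  Solutions are built interval by interval (\<open>extend_one_interval\<close>): at \<open>\<tau> k\<close> the margins are observed,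
  and one company follows the running maximum of its obstacle up to \<open>\<tau> (k+1)\<close> while the other waits.
  The running maximum is adapted since for continuous demand it is a countable supremum, and the
  decision is adapted since it depends on the margins at \<open>\<tau> k\<close> only.

  When both margins are nonnegative on the interval, the choice of the builder is free. If the demand
  exceeds the installed capacity there with positive probability, the two choices give different
  capacities, so at least one of them differs from any given solution (\<open>another_solution\<close>). On the
  first interval nothing is installed and the demand starts at \<open>x > 0\<close>, so this is always the case.
  That Nash equilibria are not unique then follows from the characterization of equilibria by the
  Skorohod problem, which is the hypothesis of the last part.
\<close>

section \<open>Capacity paths and their Stieltjes measures\<close>

definition capacity_path :: "(real \<Rightarrow> real) \<Rightarrow> bool" where
  "capacity_path u \<longleftrightarrow>
     0 \<le> u 0 \<and> mono_on {0..} u \<and> (\<forall>t\<ge>0. continuous (at_right t) u)"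

lemma capacity_path_mono:
  "capacity_path u \<Longrightarrow> 0 \<le> s \<Longrightarrow> s \<le> t \<Longrightarrow> u s \<le> u t"
  by (auto simp: capacity_path_def intro: mono_onD)

lemma capacity_path_nonneg:
  "capacity_path u \<Longrightarrow> 0 \<le> t \<Longrightarrow> 0 \<le> u t"
  using capacity_path_mono[of u 0 t] by (auto simp: capacity_path_def)

lemma zero_before_nonneg_time [simp]: "0 \<le> t \<Longrightarrow> zero_before u t = u t"
  by (simp add: zero_before_def)

lemma zero_before_mono:
  "capacity_path u \<Longrightarrow> s \<le> t \<Longrightarrow> zero_before u s \<le> zero_before u t"
  using capacity_path_mono[of u s t] capacity_path_nonneg[of u t]
  by (auto simp: zero_before_def)

lemma zero_before_right_continuous:
  assumes "capacity_path u"
  shows "continuous (at_right t) (zero_before u)"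
proof (cases "0 \<le> t")
  case True
  have "(u \<longlongrightarrow> u t) (at_right t)"
    using assms True by (auto simp: capacity_path_def continuous_within)
  moreover have "\<forall>\<^sub>F s in at_right t. u s = zero_before u s"
    using True by (auto simp: eventually_at_filter)
  ultimately have "(zero_before u \<longlongrightarrow> u t) (at_right t)"
    by (rule Lim_transform_eventually)
  then show ?thesis using True by (simp add: continuous_within)
next
  case False
  have "\<forall>\<^sub>F s in at_right t. (0::real) = zero_before u s"
    using False eventually_at_right_less[of t] eventually_at_right_field[of _ t]
    by (auto simp: zero_before_def intro!: exI[of _ 0])
  then have "(zero_before u \<longlongrightarrow> 0) (at_right t)"
    by (rule Lim_transform_eventually[OF tendsto_const])
  then show ?thesis using False by (simp add: continuous_within zero_before_def)
qed

lemma tendsto_left_value: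
  assumes "capacity_path u"
  shows "(zero_before u \<longlongrightarrow> left_value u t) (at_left t)"
proof -
  have "(zero_before u \<longlongrightarrow> Sup (zero_before u ` ({..<t} \<inter> UNIV))) (at t within ({..<t} \<inter> UNIV))"
    by (rule Lim_left_bound[where K = "zero_before u t"])
      (auto intro: zero_before_mono[OF assms])
  then have *: "(zero_before u \<longlongrightarrow> Sup (zero_before u ` {..<t})) (at_left t)"
    by simp
  then have "left_value u t = Sup (zero_before u ` {..<t})"
    unfolding left_value_def by (intro tendsto_Lim) auto
  with * show ?thesis by simp
qed

lemma left_value_le_zero_before:
  assumes "capacity_path u"
  shows "left_value u t \<le> zero_before u t"
  by (rule tendsto_upperbound[OF tendsto_left_value[OF assms]])
    (auto simp: eventually_at_filter intro!: always_eventually zero_before_mono[OF assms])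

lemma zero_before_le_left_value:
  assumes "capacity_path u" "s < t"
  shows "zero_before u s \<le> left_value u t"
  by (rule tendsto_lowerbound[OF tendsto_left_value[OF assms(1)]])
    (use assms(2) in \<open>auto simp: eventually_at_left_field intro!: exI[of _ s] zero_before_mono[OF assms(1)]\<close>)

lemma left_value_nonneg:
  assumes "capacity_path u"
  shows "0 \<le> left_value u t"
proof -
  have "min (t - 1) (- 1) < t" "min (t - 1) (- 1) < 0" by auto
  with zero_before_le_left_value[OF assms, of "min (t - 1) (- 1)" t] show ?thesis
    by (simp only: zero_before_def if_True)
qed

lemma left_value_le:
  assumes "capacity_path u" "0 \<le> a" "a \<le> t"
  shows "left_value u a \<le> u t"
  using left_value_le_zero_before[OF assms(1), of a] capacity_path_mono[OF assms] assms(2)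
  by simp

lemma left_value_cong:
  assumes "\<And>s. 0 \<le> s \<Longrightarrow> s < t \<Longrightarrow> u s = v s"
  shows "left_value u t = left_value v t"
proof -
  have "\<forall>\<^sub>F s in at_left t. zero_before u s = zero_before v s"
    using assms by (auto simp: eventually_at_filter zero_before_def)
  then show ?thesis
    unfolding left_value_def Topological_Spaces.Lim_def by (simp cong: tendsto_cong)
qed

lemma sets_stieltjes [simp, measurable_cong]: "sets (stieltjes u) = sets borel"
  by (simp add: stieltjes_def)

lemma space_stieltjes [simp]: "space (stieltjes u) = UNIV"
  by (simp add: stieltjes_def)

lemma emeasure_stieltjes_Ioc:
  assumes "capacity_path u" "a \<le> t"
  shows "emeasure (stieltjes u) {a<..t} = ennreal (zero_before u t - zero_before u a)"
  unfolding stieltjes_def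
  by (rule emeasure_interval_measure_Ioc[OF assms(2)])
    (auto intro: zero_before_mono zero_before_right_continuous assms(1))

text \<open>
The atom at \<open>a\<close> is charged, so the closed interval is the limit of the half-open ones starting
just before \<open>a\<close>; their masses involve \<open>u\<close> at times approaching \<open>a\<close> from the left. At \<open>a = 0\<close>
this includes the initial jump \<open>u(0)\<close>.
\<close>

lemma emeasure_stieltjes_Icc:
  assumes "capacity_path u" "a \<le> t"
  shows "emeasure (stieltjes u) {a..t} = ennreal (zero_before u t - left_value u a)"
proof -
  define A where "A i = {a - 1 / real (Suc i)<..t}" for i
  have A: "(\<Inter>i. A i) = {a..t}"
  proof (intro set_eqI iffI)
    fix s assume s: "s \<in> (\<Inter>i. A i)"
    have "a \<le> s"
    proof (rule ccontr)
      assume "\<not> a \<le> s"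
      then obtain i where "1 / real (Suc i) < a - s"
        using nat_approx_posE[of "a - s"] by auto
      with s show False by (auto simp: A_def dest!: spec[of _ i])
    qed
    with s show "s \<in> {a..t}" by (auto simp: A_def)
  next
    fix s assume "s \<in> {a..t}"
    then show "s \<in> (\<Inter>i. A i)"
      unfolding A_def by (auto intro!: less_le_trans[of _ a s])
  qed
  have em: "emeasure (stieltjes u) (A i) =
      ennreal (zero_before u t - zero_before u (a - 1 / real (Suc i)))" for i
    unfolding A_def
  proof (rule emeasure_stieltjes_Ioc[OF assms(1)])
    have "0 \<le> 1 / real (Suc i)" by simp
    with assms(2) show "a - 1 / real (Suc i) \<le> t" by linarith
  qed
  have "decseq A"
  proof (rule decseq_SucI)
    fix i
    have "1 / real (Suc (Suc i)) \<le> 1 / real (Suc i)" by (intro frac_le) auto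
    then show "A (Suc i) \<subseteq> A i" unfolding A_def by auto
  qed
  then have "(\<lambda>i. emeasure (stieltjes u) (A i)) \<longlonglongrightarrow> emeasure (stieltjes u) (\<Inter>i. A i)"
    by (intro Lim_emeasure_decseq) (simp_all add: em image_subset_iff, simp add: A_def)
  moreover have "(\<lambda>i. ennreal (zero_before u t - zero_before u (a - 1 / real (Suc i))))
      \<longlonglongrightarrow> ennreal (zero_before u t - left_value u a)"
  proof (intro tendsto_ennrealI tendsto_diff tendsto_const)
    have "filterlim (\<lambda>i. a - 1 / real (Suc i)) (at_left a) sequentially"
      unfolding filterlim_at
      using tendsto_diff[OF tendsto_const[of a] LIMSEQ_inverse_real_of_nat]
      by (auto simp: inverse_eq_divide)
    then show "(\<lambda>i. zero_before u (a - 1 / real (Suc i))) \<longlonglongrightarrow> left_value u a"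
      by (rule filterlim_compose[OF tendsto_left_value[OF assms(1)]])
  qed
  ultimately show ?thesis
    unfolding A em by (rule LIMSEQ_unique)
qed

lemma AE_stieltjes_outside_flat:
  assumes "capacity_path u" "0 \<le> r" "r \<le> s" "u s = u r"
  shows "AE t in stieltjes u. t \<notin> {r<..s}"
  by (rule AE_not_in)
    (use assms in \<open>auto simp: null_sets_def emeasure_stieltjes_Ioc\<close>)

lemma capacity_path_zero: "capacity_path (\<lambda>_. 0)"
  by (auto simp: capacity_path_def mono_on_def)

lemma left_value_zero: "left_value (\<lambda>_. 0) t = 0"
  using left_value_nonneg[OF capacity_path_zero, of t] 
    left_value_le_zero_before[OF capacity_path_zero, of t]
  by (simp add: zero_before_def split: if_splits)

text \<open>
At time 0 the convention \<open>u(0-) = 0\<close> makes the recursion start from empty capacities.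
\<close>

lemma left_value_0: "capacity_path u \<Longrightarrow> left_value u 0 = 0"
  by (rule antisym[OF _ left_value_nonneg], rule tendsto_upperbound[OF tendsto_left_value])
    (auto simp: eventually_at_filter zero_before_def)

text \<open>
Lets a single controller be treated as one of two controllers whose partner never builds.
\<close>

lemma AE_stieltjes_zero: "AE t in stieltjes (\<lambda>_. 0). P t"
proof -
  have "AE t in stieltjes (\<lambda>_. 0). \<forall>n::nat. t \<notin> {- real n<..real n}"
    unfolding AE_all_countable
    by (intro allI AE_not_in)
      (auto simp: null_sets_def emeasure_stieltjes_Ioc capacity_path_zero zero_before_def)
  then show ?thesis
  proof eventually_elim
    case (elim t)
    obtain n where "\<bar>t\<bar> < real n" using reals_Archimedean2 by blast
    with elim[rule_format, of n] show ?case by auto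
  qed
qed

section \<open>Running maxima\<close>

text \<open>
This is the expression in the floored recursion rule, with \<open>q\<close> the capacity installed before
\<open>a\<close>. For \<open>q \<ge> 0\<close> it is the least upper bound of \<open>q\<close> and of the values of \<open>Z\<close> on \<open>[a, t]\<close>.
\<close>

definition running_max :: "real \<Rightarrow> (real \<Rightarrow> real) \<Rightarrow> real \<Rightarrow> real \<Rightarrow> real" where
  "running_max q Z a t = max q (SUP s\<in>{a..t}. max 0 (Z s))"

text \<open>
All properties of the running maximum below are read off from this universal property. Continuity
of \<open>Z\<close> makes the supremum bounded.
\<close>

lemma running_max_le_iff:
  assumes "0 \<le> q" "a \<le> t" "continuous_on {a..t} Z"
  shows "running_max q Z a t \<le> c \<longleftrightarrow> q \<le> c \<and> (\<forall>s\<in>{a..t}. Z s \<le> c)"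
proof -
  have "compact ((\<lambda>s. max 0 (Z s)) ` {a..t})"
    by (intro compact_continuous_image continuous_intros assms) auto
  then have "bdd_above ((\<lambda>s. max 0 (Z s)) ` {a..t})"
    by (intro bounded_imp_bdd_above compact_imp_bounded)
  then have "(SUP s\<in>{a..t}. max 0 (Z s)) \<le> c \<longleftrightarrow> (\<forall>s\<in>{a..t}. max 0 (Z s) \<le> c)"
    using assms(2) by (intro cSUP_le_iff) auto
  then show ?thesis
    using assms(1,2) by (auto simp: running_max_def)
qed

lemma running_max_upper:
  assumes "0 \<le> q" "a \<le> t" "continuous_on {a..t} Z"
  shows "q \<le> running_max q Z a t" "s \<in> {a..t} \<Longrightarrow> Z s \<le> running_max q Z a t"
  using running_max_le_iff[OF assms, of "running_max q Z a t"] by auto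

lemma running_max_mono:
  assumes "0 \<le> q" "a \<le> s" "s \<le> t" "continuous_on {a..t} Z"
  shows "running_max q Z a s \<le> running_max q Z a t"
proof -
  have "continuous_on {a..s} Z"
    by (rule continuous_on_subset[OF assms(4)]) (use assms in auto)
  then show ?thesis
    using running_max_le_iff[OF assms(1,2)] running_max_upper[OF assms(1) _ assms(4)] assms
    by auto
qed

text \<open>
Just after \<open>t\<close> the function \<open>Z\<close> stays close to \<open>Z t\<close>, hence barely exceeds the maximum attained
up to \<open>t\<close>.
\<close>

lemma running_max_right_continuous:
  assumes q: "0 \<le> q" and t: "a \<le> t" "t < b" and Z: "continuous_on {a..b} Z"
  shows "(running_max q Z a \<longlongrightarrow> running_max q Z a t) (at_right t)"
proof (rule order_tendstoI)
  have Zs: "continuous_on {a..s} Z" if "s \<le> b" for s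
    by (rule continuous_on_subset[OF Z]) (use that in auto)
  have near: "\<forall>\<^sub>F s in at_right t. t < s \<and> s < b"
    unfolding eventually_at_right_field using t by (intro exI[of _ b]) auto
  {
    fix y assume y: "y < running_max q Z a t"
    show "\<forall>\<^sub>F s in at_right t. y < running_max q Z a s"
      using near
    proof eventually_elim
      case (elim s)
      then show ?case
        using running_max_mono[OF q t(1), of s, OF _ Zs] y by auto
    qed
  next
    fix y assume "running_max q Z a t < y"
    then obtain m where m: "running_max q Z a t < m" "m < y" using dense by blast
    have "Z t \<le> running_max q Z a t"
      using running_max_upper(2)[OF q t(1) Zs, of t] t by auto
    then have "Z t < m" using m by simp
    moreover have "(Z \<longlongrightarrow> Z t) (at t within {a..b})"
      using Z t by (auto simp: continuous_on_def)
    ultimately have "\<forall>\<^sub>F s in at t within {a..b}. Z s < m"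
      by (intro order_tendstoD)
    then obtain e where e: "0 < e" "\<And>s. s \<in> {a..b} \<Longrightarrow> s \<noteq> t \<Longrightarrow> dist s t < e \<Longrightarrow> Z s < m"
      unfolding eventually_at by auto
    have "\<forall>\<^sub>F s in at_right t. t < s \<and> s < min b (t + e)"
      unfolding eventually_at_right_field using t e by (intro exI[of _ "min b (t + e)"]) auto
    then show "\<forall>\<^sub>F s in at_right t. running_max q Z a s < y"
    proof eventually_elim
      case (elim s)
      have "running_max q Z a s \<le> m"
      proof (subst running_max_le_iff[OF q _ Zs], goal_cases)
        case 3
        show ?case
        proof (intro conjI ballI)
          show "q \<le> m"
            using running_max_upper(1)[OF q t(1) Zs] t m by auto
        next
          fix r assume r: "r \<in> {a..s}"
          show "Z r \<le> m"
          proof (cases "r \<le> t")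
            case True
            then show ?thesis
              using running_max_upper(2)[OF q t(1) Zs, of r] t m r by auto
          next
            case False
            then show ?thesis
              using e(2)[of r] r elim by (auto simp: dist_real_def)
          qed
        qed
      qed (use elim t in auto)
      then show ?case using m by simp
    qed
  }
qed

text \<open>
Lifting the obstacle and the floor by the same amount lifts the running maximum by it. Therefore,
if company 2 keeps its capacity \<open>q\<close> and company 1 tracks \<open>X - q\<close>, the total capacity tracks \<open>X\<close>.
\<close>

lemma running_max_shift:
  assumes "0 \<le> p" "0 \<le> q" "a \<le> t" "continuous_on {a..t} Z"
  shows "running_max p (\<lambda>s. Z s - q) a t + q = running_max (p + q) Z a t"
proof (rule antisym)
  have Zq: "continuous_on {a..t} (\<lambda>s. Z s - q)"
    by (intro continuous_intros assms)
  have pq: "0 \<le> p + q" using assms by simp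
  note upper = running_max_upper[OF assms(1,3) Zq] and upper' = running_max_upper[OF pq assms(3,4)]
  have "running_max p (\<lambda>s. Z s - q) a t \<le> running_max (p + q) Z a t - q"
    unfolding running_max_le_iff[OF assms(1,3) Zq] using upper' by (auto simp: algebra_simps)
  then show "running_max p (\<lambda>s. Z s - q) a t + q \<le> running_max (p + q) Z a t" by simp
  show "running_max (p + q) Z a t \<le> running_max p (\<lambda>s. Z s - q) a t + q"
    unfolding running_max_le_iff[OF pq assms(3,4)] using upper by (fastforce simp: algebra_simps)
qed

lemma running_max_zero: "0 \<le> q \<Longrightarrow> a \<le> t \<Longrightarrow> running_max q (\<lambda>_. 0) a t = q"
  by (simp add: running_max_def)

text \<open>
For continuous paths the uncountable supremum equals the one over a countable dense set of times.
\<close>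

lemma borel_measurable_running_max:
  assumes "a \<le> t" and q: "q \<in> borel_measurable N"
    and Z: "\<And>s. s \<in> {a..t} \<Longrightarrow> Z s \<in> borel_measurable N"
    and cont: "\<And>\<omega>. \<omega> \<in> space N \<Longrightarrow> continuous_on {a..t} (\<lambda>s. Z s \<omega>)"
  shows "(\<lambda>\<omega>. running_max (q \<omega>) (\<lambda>s. Z s \<omega>) a t) \<in> borel_measurable N"
proof -
  obtain D where D: "countable D" "D \<subseteq> {a..t}" "{a..t} \<subseteq> closure D"
    using separable[of "{a..t}"] by blast
  have closure: "closure D = {a..t}"
    using D closure_minimal[OF D(2)] by auto
  have "D \<noteq> {}" using closure \<open>a \<le> t\<close> by auto
  have bdd: "bdd_above ((\<lambda>s. max 0 (Z s \<omega>)) ` {a..t})" if "\<omega> \<in> space N" for \<omega>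
    by (intro bounded_imp_bdd_above compact_imp_bounded compact_continuous_image
        continuous_intros cont that) auto
  then have bdd_D: "bdd_above ((\<lambda>s. max 0 (Z s \<omega>)) ` D)" if "\<omega> \<in> space N" for \<omega>
    using that D(2) by (meson bdd_above_mono image_mono)
  have eq: "(SUP s\<in>{a..t}. max 0 (Z s \<omega>)) = (SUP s\<in>D. max 0 (Z s \<omega>))" if \<omega>: "\<omega> \<in> space N" for \<omega>
  proof (rule antisym)
    show "(SUP s\<in>D. max 0 (Z s \<omega>)) \<le> (SUP s\<in>{a..t}. max 0 (Z s \<omega>))"
      by (intro cSUP_subset_mono \<open>D \<noteq> {}\<close> bdd \<omega> D) auto
    show "(SUP s\<in>{a..t}. max 0 (Z s \<omega>)) \<le> (SUP s\<in>D. max 0 (Z s \<omega>))"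
    proof (rule cSUP_least)
      fix s assume "s \<in> {a..t}"
      then show "max 0 (Z s \<omega>) \<le> (SUP s\<in>D. max 0 (Z s \<omega>))"
        using closure
        by (intro continuous_le_on_closure[where S = D and f = "\<lambda>s. max 0 (Z s \<omega>)",
              OF _ _ cSUP_upper[OF _ bdd_D[OF \<omega>]]])
          (auto intro!: continuous_intros cont \<omega>)
    qed (use \<open>a \<le> t\<close> in auto)
  qed
  have "(\<lambda>\<omega>. SUP s\<in>D. max 0 (Z s \<omega>)) \<in> borel_measurable N"
    using Z D by (intro borel_measurable_cSUP bdd_D borel_measurable_max borel_measurable_const) auto
  then have *: "(\<lambda>\<omega>. max (q \<omega>) (SUP s\<in>D. max 0 (Z s \<omega>))) \<in> borel_measurable N"
    using q by (intro borel_measurable_max)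
  show ?thesis
    by (rule measurable_cong[THEN iffD1, OF _ *]) (simp add: running_max_def eq)
qed

section \<open>The Skorohod lemma for two controllers\<close>

text \<open>
The minimality half of the Skorohod lemma. To get from at most \<open>c\<close> to above \<open>c\<close> by time \<open>t\<close>, the sum
\<open>u + v\<close> must grow, by a jump or continuously, on the time interval where it exceeds \<open>c\<close>; but this
interval is null for both Stieltjes measures, so both summands are flat on it. The interval
contains its left end point \<open>d\<close> exactly when the level is passed by a jump at \<open>d\<close>, and then the
left limits at \<open>d\<close> are the values to compare with.
\<close>

lemma stays_below_level:
  assumes u: "capacity_path u" and v: "capacity_path v" and a: "0 \<le> a" "a \<le> t"
    and start: "left_value u a + left_value v a \<le> c"
    and Nu: "AE s in stieltjes u. s \<in> {a..t} \<longrightarrow> u s + v s \<le> c"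
    and Nv: "AE s in stieltjes v. s \<in> {a..t} \<longrightarrow> u s + v s \<le> c"
  shows "u t + v t \<le> c"
proof (rule ccontr)
  assume above: "\<not> u t + v t \<le> c"
  define S where "S = {s\<in>{a..t}. c < u s + v s}"
  define d where "d = Inf S"
  have tS: "t \<in> S" using above a by (auto simp: S_def)
  have bdd: "bdd_below S" by (auto simp: S_def intro!: bdd_belowI[of _ a])
  have d: "a \<le> d" "d \<le> t"
    using tS bdd by (auto simp: d_def S_def intro!: cInf_greatest cInf_lower)
  have after: "s \<in> S" if "d < s" "s \<le> t" for s
  proof -
    obtain r where r: "r \<in> S" "r < s"
      using \<open>d < s\<close> cInf_lessD[of S s] tS unfolding d_def by auto
    then show ?thesis
      using that d a capacity_path_mono[OF u, of r s] capacity_path_mono[OF v, of r s]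
      by (auto simp: S_def)
  qed
  have null: "emeasure (stieltjes w) I = 0"
    if "AE s in stieltjes w. s \<in> {a..t} \<longrightarrow> u s + v s \<le> c" "I \<subseteq> S" "I \<in> sets borel" for w I
  proof -
    have "AE s in stieltjes w. s \<notin> I"
      using that(1) by eventually_elim (use that(2) in \<open>auto simp: S_def\<close>)
    then show ?thesis
      using that(3) by (subst (asm) AE_iff_measurable[where N = I]) auto
  qed
  show False
  proof (cases "d \<in> S")
    case True
    then have I: "{d..t} \<subseteq> S" using after by force
    have "u t \<le> left_value u d" "v t \<le> left_value v d"
      using null[OF Nu I] null[OF Nv I] emeasure_stieltjes_Icc[OF u d(2)]
        emeasure_stieltjes_Icc[OF v d(2)] a d by (auto simp: ennreal_eq_0_iff)
    moreover have "left_value u d + left_value v d \<le> c"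
    proof (cases "d = a")
      case False
      then have "a < d" using d by simp
      have "\<forall>\<^sub>F s in at_left d. zero_before u s + zero_before v s \<le> c"
        unfolding eventually_at_left_field
      proof (intro exI[of _ a] conjI allI impI \<open>a < d\<close>)
        fix s assume s: "a < s" "s < d"
        then have "s \<notin> S" using bdd by (auto simp: d_def dest: cInf_lower)
        then show "zero_before u s + zero_before v s \<le> c"
          using s a d by (auto simp: S_def)
      qed
      then show ?thesis
        by (intro tendsto_upperbound[OF tendsto_add[OF tendsto_left_value[OF u] tendsto_left_value[OF v]]])
          auto
    qed (use start in simp)
    ultimately show False using above by simp
  next
    case False
    have I: "{d<..t} \<subseteq> S" using after by force
    have "u t \<le> u d" "v t \<le> v d"
      using null[OF Nu I] null[OF Nv I] emeasure_stieltjes_Ioc[OF u d(2)]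
        emeasure_stieltjes_Ioc[OF v d(2)] a d by (auto simp: ennreal_eq_0_iff)
    then show False using False above d by (auto simp: S_def)
  qed
qed

text \<open>
A running maximum grows only while it touches the obstacle. If \<open>u + v\<close> is strictly above \<open>Z\<close> at
\<open>t > a\<close>, then by continuity of \<open>Z\<close> it is constant on an interval with rational end points around \<open>t\<close>.
Both summands are nondecreasing, so \<open>u\<close> is constant there as well, and countably many such
intervals carry no mass of its Stieltjes measure. At \<open>a\<close> there is no room to the left; but if
\<open>u + v\<close> is above \<open>Z\<close> there, then it equals the floor and neither summand has jumped.
\<close>

lemma AE_stieltjes_running_max_contact:
  assumes u: "capacity_path u" and v: "capacity_path v" and a: "0 \<le> a" "a < b"
    and Z: "continuous_on {a..<b} Z"
    and max: "\<forall>t\<in>{a..<b}. u t + v t = running_max (left_value u a + left_value v a) Z a t"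
  shows "AE t in stieltjes u. t \<in> {a..<b} \<longrightarrow> u t + v t = Z t"
proof -
  define q where "q = left_value u a + left_value v a"
  have q: "0 \<le> q" using u v by (auto simp: q_def left_value_nonneg)
  have Zt: "continuous_on {a..t} Z" if "t < b" for t
    by (rule continuous_on_subset[OF Z]) (use that in auto)
  note le_iff = running_max_le_iff[OF q _ Zt] and upper = running_max_upper[OF q _ Zt]
  have w: "u t + v t = running_max q Z a t" if "a \<le> t" "t < b" for t
    using max that by (auto simp: q_def)
  have flat: "AE t in stieltjes u. \<forall>(r, s)\<in>\<rat> \<times> \<rat>.
      a \<le> r \<and> r \<le> s \<and> u s + v s = u r + v r \<longrightarrow> t \<notin> {r<..s}"
    unfolding split_def
  proof (subst AE_ball_countable, goal_cases)
    case 2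
    show ?case
    proof (intro ballI)
      fix p :: "real \<times> real"
      show "AE t in stieltjes u. a \<le> fst p \<and> fst p \<le> snd p \<and>
          u (snd p) + v (snd p) = u (fst p) + v (fst p) \<longrightarrow> t \<notin> {fst p<..snd p}"
      proof (cases "a \<le> fst p \<and> fst p \<le> snd p \<and> u (snd p) + v (snd p) = u (fst p) + v (fst p)")
        case True
        then have "u (snd p) = u (fst p)"
          using a capacity_path_mono[OF u, of "fst p" "snd p"] capacity_path_mono[OF v, of "fst p" "snd p"]
          by auto
        then show ?thesis
          using AE_stieltjes_outside_flat[OF u, of "fst p" "snd p"] a True by auto
      qed auto
    qed
  qed (auto intro: countable_rat)
  have start: "AE t in stieltjes u. u a + v a \<noteq> Z a \<longrightarrow> t \<noteq> a"
  proof (cases "u a + v a = Z a")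
    case False
    then have "Z a < u a + v a"
      using upper(2)[of a a] w[of a] a by auto
    moreover have "u a + v a \<le> max q (Z a)"
      using le_iff[of a "max q (Z a)"] w[of a] a by auto
    ultimately have "u a = left_value u a"
      using left_value_le[OF u a(1), of a] left_value_le[OF v a(1), of a]
      by (auto simp: q_def)
    then have "{a} \<in> null_sets (stieltjes u)"
      using emeasure_stieltjes_Icc[OF u, of a a] a by (auto simp: null_sets_def)
    from AE_not_in[OF this] show ?thesis by auto
  qed simp
  from flat start show ?thesis
  proof eventually_elim
    case (elim t)
    show ?case
    proof (rule impI, rule ccontr)
      assume t: "t \<in> {a..<b}" and ne: "u t + v t \<noteq> Z t"
      from ne have "t \<noteq> a" using elim(2) by auto
      then have at: "a < t" and tb: "t < b" using t by simp_all
      \<comment> \<open>A level strictly between obstacle and capacity keeps the bounds strict on a closed interval.\<close>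
      define m where "m = (Z t + (u t + v t)) / 2"
      have "Z t < u t + v t"
        using ne upper(2)[of t t] w[of t] t by auto
      then have m: "Z t < m" "m < u t + v t" by (auto simp: m_def)
      have "continuous_on {a<..<b} Z"
        by (rule continuous_on_subset[OF Z]) auto
      then have "isCont Z t"
        using at t by (simp add: continuous_on_eq_continuous_at)
      then have "\<forall>\<^sub>F r in nhds t. Z r < m"
        using m(1) by (intro order_tendstoD) (auto simp: isCont_def tendsto_at_iff_tendsto_nhds)
      then obtain e where e: "0 < e" "\<And>r. dist r t < e \<Longrightarrow> Z r < m"
        unfolding eventually_nhds_metric by auto
      obtain r where r: "r \<in> \<rat>" "max a (t - e) < r" "r < t"
        using Rats_dense_in_real[of "max a (t - e)" t] at e by auto
      obtain s where s: "s \<in> \<rat>" "t < s" "s < min b (t + e)"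
        using Rats_dense_in_real[of t "min b (t + e)"] t e by auto
      have Zm: "Z y \<le> m" if "r \<le> y" "y \<le> s" for y
        using that r s by (intro less_imp_le e(2)) (auto simp: dist_real_def)
      have "running_max q Z a t \<le> max (u r + v r) m"
        unfolding le_iff[OF less_imp_le[OF at] tb]
      proof (intro conjI ballI)
        show "q \<le> max (u r + v r) m"
          using upper(1)[of r] w[of r] r t by auto
      next
        fix y assume y: "y \<in> {a..t}"
        show "Z y \<le> max (u r + v r) m"
          using upper(2)[of r y] w[of r] Zm[of y] r s t y by (cases "y \<le> r") auto
      qed
      then have "u t + v t \<le> u r + v r"
        using w[of t] m(2) at t by auto
      moreover have "running_max q Z a s \<le> u t + v t"
      proof (subst le_iff, goal_cases)
        case 3
        show ?case
        proof (intro conjI ballI)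
          show "q \<le> u t + v t"
            using upper(1)[of t] w[of t] at t by auto
        next
          fix y assume y: "y \<in> {a..s}"
          show "Z y \<le> u t + v t"
            using upper(2)[of t y] w[of t] Zm[of y] m(2) r s at t y by (cases "y \<le> t") auto
        qed
      qed (use at s in auto)
      then have "u s + v s \<le> u t + v t"
        using w[of s] s at by auto
      moreover have "u r \<le> u s" "v r \<le> v s"
        using r s a capacity_path_mono[OF u, of r s] capacity_path_mono[OF v, of r s] by auto
      ultimately have "u s + v s = u r + v r" by simp
      then show False
        using elim(1)[rule_format, of "(r, s)"] r s by auto
    qed
  qed
qed

text \<open>
The density of the reflection condition is nonnegative on the interval, so its integral vanishes
exactly when the constraint is active almost everywhere for the Stieltjes measure.
\<close>

definition reflected_on :: "real \<Rightarrow> real \<Rightarrow> (real \<Rightarrow> real) \<Rightarrow> (real \<Rightarrow> real) \<Rightarrow> bool" where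
  "reflected_on a b Y u \<longleftrightarrow>
     (\<forall>t\<in>{a..<b}. Y t \<le> u t) \<and> (AE t in stieltjes u. t \<in> {a..<b} \<longrightarrow> u t = Y t)"

lemma reflected_on_cong:
  assumes "\<And>t. t \<in> {a..<b} \<Longrightarrow> Y t = Y' t"
  shows "reflected_on a b Y u \<longleftrightarrow> reflected_on a b Y' u"
proof -
  have "(t \<in> {a..<b} \<longrightarrow> u t = Y t) \<longleftrightarrow> (t \<in> {a..<b} \<longrightarrow> u t = Y' t)" for t
    using assms by auto
  then show ?thesis
    using assms by (simp add: reflected_on_def)
qed

text \<open>
The Skorohod lemma for an obstacle supported by two controllers: the reflection conditions
determine the sum, while its split among the two is arbitrary. This is the source of
non-uniqueness.
\<close>

lemma reflected_pair_iff_running_max: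
  assumes u: "capacity_path u" and v: "capacity_path v" and a: "0 \<le> a" "a < b"
    and Z: "continuous_on {a..<b} Z"
  shows "reflected_on a b (\<lambda>t. Z t - v t) u \<and> reflected_on a b (\<lambda>t. Z t - u t) v \<longleftrightarrow>
    (\<forall>t\<in>{a..<b}. u t + v t = running_max (left_value u a + left_value v a) Z a t)"
    (is "?refl \<longleftrightarrow> ?max")
proof
  define q where "q = left_value u a + left_value v a"
  have q: "0 \<le> q" using u v by (auto simp: q_def left_value_nonneg)
  have Zt: "continuous_on {a..t} Z" if "t < b" for t
    by (rule continuous_on_subset[OF Z]) (use that in auto)
  note upper = running_max_upper[OF q _ Zt]
  {
    assume refl: ?refl
    show ?max
      unfolding q_def[symmetric]
    proof (intro ballI antisym)
      fix t assume t: "t \<in> {a..<b}"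
      show "running_max q Z a t \<le> u t + v t"
      proof (subst running_max_le_iff[OF q _ Zt], goal_cases)
        case 3
        show ?case
        proof (intro conjI ballI)
          show "q \<le> u t + v t"
            using left_value_le[OF u a(1), of t] left_value_le[OF v a(1), of t] t
            by (auto simp: q_def)
        next
          fix s assume s: "s \<in> {a..t}"
          have "Z s \<le> u s + v s"
            using refl s t by (auto simp: reflected_on_def dest!: bspec[of _ _ s])
          then show "Z s \<le> u t + v t"
            using capacity_path_mono[OF u, of s t] capacity_path_mono[OF v, of s t] s a by auto
        qed
      qed (use t in auto)
      show "u t + v t \<le> running_max q Z a t"
      proof (rule stays_below_level[OF u v a(1)])
        show "AE s in stieltjes u. s \<in> {a..t} \<longrightarrow> u s + v s \<le> running_max q Z a t"
          using conjunct1[OF refl, unfolded reflected_on_def, THEN conjunct2]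
          by eventually_elim (use upper(2)[of t] t in auto)
        show "AE s in stieltjes v. s \<in> {a..t} \<longrightarrow> u s + v s \<le> running_max q Z a t"
          using conjunct2[OF refl, unfolded reflected_on_def, THEN conjunct2]
          by eventually_elim (use upper(2)[of t] t in auto)
        show "left_value u a + left_value v a \<le> running_max q Z a t"
          using upper(1)[of t] t by (auto simp: q_def)
      qed (use t in auto)
    qed
  next
    assume max: ?max
    have above: "Z t \<le> u t + v t" if "t \<in> {a..<b}" for t
      using max upper(2)[of t t] that by (auto simp: q_def)
    have "AE t in stieltjes u. t \<in> {a..<b} \<longrightarrow> u t = Z t - v t"
      using AE_stieltjes_running_max_contact[OF u v a Z max] by eventually_elim auto
    moreover have "AE t in stieltjes v. t \<in> {a..<b} \<longrightarrow> v t = Z t - u t"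
      using AE_stieltjes_running_max_contact[OF v u a Z] max
      by (simp add: add.commute algebra_simps)
    ultimately show ?refl
      using above by (auto simp: reflected_on_def algebra_simps)
  }
qed

lemma reflected_on_iff_running_max:
  assumes "capacity_path u" "0 \<le> a" "a < b" "continuous_on {a..<b} Z"
  shows "reflected_on a b Z u \<longleftrightarrow> (\<forall>t\<in>{a..<b}. u t = running_max (left_value u a) Z a t)"
proof -
  have "reflected_on a b (\<lambda>t. Z t - u t) (\<lambda>_. 0)" if "reflected_on a b Z u"
    using that by (auto simp: reflected_on_def AE_stieltjes_zero)
  then show ?thesis
    using reflected_pair_iff_running_max[OF assms(1) capacity_path_zero assms(2-4)]
    by (auto simp: left_value_zero)
qed

lemma reflected_on_zero_iff:
  assumes "capacity_path u" "0 \<le> a" "a < b"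
  shows "reflected_on a b (\<lambda>_. 0) u \<longleftrightarrow> (\<forall>t\<in>{a..<b}. u t = left_value u a)"
proof -
  have "running_max (left_value u a) (\<lambda>_. 0) a t = left_value u a" if "t \<in> {a..<b}" for t
    using that left_value_nonneg[OF assms(1), of a] by (auto simp: running_max_def)
  then show ?thesis
    using reflected_on_iff_running_max[OF assms, of "\<lambda>_. 0"] by auto
qed

section \<open>One interval of constant signs\<close>

text \<open>
Because the signs are constant, the case that applies can be read off at time \<open>a\<close>, when an adapted
construction has to decide who builds.
\<close>

lemma sign_pattern_iff_at_start:
  fixes a b :: real and g1 g2 :: "real \<Rightarrow> real"
  assumes ab: "a < b"
    and g1: "(\<forall>t\<in>{a..<b}. g1 t < 0) \<or> (\<forall>t\<in>{a..<b}. 0 \<le> g1 t)"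
    and g2: "(\<forall>t\<in>{a..<b}. g2 t < 0) \<or> (\<forall>t\<in>{a..<b}. 0 \<le> g2 t)"
  shows "(\<forall>t\<in>{a..<b}. g1 t < 0 \<and> g2 t < 0) \<longleftrightarrow> g1 a < 0 \<and> g2 a < 0"
    and "(\<forall>t\<in>{a..<b}. g1 t < 0 \<and> 0 \<le> g2 t) \<longleftrightarrow> g1 a < 0 \<and> \<not> g2 a < 0"
    and "(\<forall>t\<in>{a..<b}. 0 \<le> g1 t \<and> g2 t < 0) \<longleftrightarrow> \<not> g1 a < 0 \<and> g2 a < 0"
    and "(\<forall>t\<in>{a..<b}. 0 \<le> g1 t \<and> 0 \<le> g2 t) \<longleftrightarrow> \<not> g1 a < 0 \<and> \<not> g2 a < 0"
proof -
  have "a \<in> {a..<b}" using ab by simp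
  with g1 g2 show
    "(\<forall>t\<in>{a..<b}. g1 t < 0 \<and> g2 t < 0) \<longleftrightarrow> g1 a < 0 \<and> g2 a < 0"
    "(\<forall>t\<in>{a..<b}. g1 t < 0 \<and> 0 \<le> g2 t) \<longleftrightarrow> g1 a < 0 \<and> \<not> g2 a < 0"
    "(\<forall>t\<in>{a..<b}. 0 \<le> g1 t \<and> g2 t < 0) \<longleftrightarrow> \<not> g1 a < 0 \<and> g2 a < 0"
    "(\<forall>t\<in>{a..<b}. 0 \<le> g1 t \<and> 0 \<le> g2 t) \<longleftrightarrow> \<not> g1 a < 0 \<and> \<not> g2 a < 0"
    by (meson not_less)+
qed

text \<open>
A company with negative margin is reflected at the obstacle 0, hence stays constant. If one margin
is nonnegative, the other company is constant and the obstacle becomes the continuous function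
\<open>X\<close> minus that constant. If both are nonnegative, the two conditions are those of the two-controller
Skorohod lemma with obstacle \<open>X\<close>.
\<close>

lemma reflected_on_iff_floored_rule:
  assumes u: "capacity_path u" and v: "capacity_path v" and a: "0 \<le> a" "a < b"
    and X: "continuous_on {a..<b} X"
    and g1: "(\<forall>t\<in>{a..<b}. g1 t < 0) \<or> (\<forall>t\<in>{a..<b}. 0 \<le> g1 t)"
    and g2: "(\<forall>t\<in>{a..<b}. g2 t < 0) \<or> (\<forall>t\<in>{a..<b}. 0 \<le> g2 t)"
  shows "reflected_on a b (\<lambda>t. (X t - v t) * indicator {0..} (g1 t)) u \<and>
      reflected_on a b (\<lambda>t. (X t - u t) * indicator {0..} (g2 t)) v \<longleftrightarrow>
    floored_recursion_rule X g1 g2 a b (left_value u a) (left_value v a) u v"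
    (is "?R1 \<and> ?R2 \<longleftrightarrow> ?rule")
proof -
  have aI: "a \<in> {a..<b}" using a by simp
  have idle1: "?R1 \<longleftrightarrow> (\<forall>t\<in>{a..<b}. u t = left_value u a)" if "\<forall>t\<in>{a..<b}. g1 t < 0"
    unfolding reflected_on_zero_iff[OF u a, symmetric]
    by (rule reflected_on_cong) (use that in \<open>force simp: indicator_def not_le\<close>)
  have idle2: "?R2 \<longleftrightarrow> (\<forall>t\<in>{a..<b}. v t = left_value v a)" if "\<forall>t\<in>{a..<b}. g2 t < 0"
    unfolding reflected_on_zero_iff[OF v a, symmetric]
    by (rule reflected_on_cong) (use that in \<open>force simp: indicator_def not_le\<close>)
  have active1: "?R1 \<longleftrightarrow> reflected_on a b (\<lambda>t. X t - v t) u" if "\<forall>t\<in>{a..<b}. 0 \<le> g1 t"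
    by (rule reflected_on_cong) (use that in auto)
  have active2: "?R2 \<longleftrightarrow> reflected_on a b (\<lambda>t. X t - u t) v" if "\<forall>t\<in>{a..<b}. 0 \<le> g2 t"
    by (rule reflected_on_cong) (use that in auto)
  have alone: "reflected_on a b (\<lambda>t. X t - v' t) u' \<longleftrightarrow>
      (\<forall>t\<in>{a..<b}. u' t = running_max (left_value u' a) (\<lambda>s. X s - c) a t)"
    if "capacity_path u'" "\<forall>t\<in>{a..<b}. v' t = c" for u' v' c
  proof -
    have "reflected_on a b (\<lambda>t. X t - v' t) u' \<longleftrightarrow> reflected_on a b (\<lambda>t. X t - c) u'"
      by (rule reflected_on_cong) (use that in auto)
    also have "\<dots> \<longleftrightarrow> (\<forall>t\<in>{a..<b}. u' t = running_max (left_value u' a) (\<lambda>s. X s - c) a t)"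
      by (intro reflected_on_iff_running_max that a continuous_intros X)
    finally show ?thesis .
  qed
  note signs = sign_pattern_iff_at_start[OF a(2) g1 g2]
  note rule_def = floored_recursion_rule_def signs running_max_def[symmetric]
  consider "\<forall>t\<in>{a..<b}. g1 t < 0" "\<forall>t\<in>{a..<b}. g2 t < 0"
    | "\<forall>t\<in>{a..<b}. g1 t < 0" "\<forall>t\<in>{a..<b}. 0 \<le> g2 t"
    | "\<forall>t\<in>{a..<b}. 0 \<le> g1 t" "\<forall>t\<in>{a..<b}. g2 t < 0"
    | "\<forall>t\<in>{a..<b}. 0 \<le> g1 t" "\<forall>t\<in>{a..<b}. 0 \<le> g2 t"
    using g1 g2 by blast
  then show ?thesis
  proof cases
    case 1
    have "?rule \<longleftrightarrow> (\<forall>t\<in>{a..<b}. u t = left_value u a \<and> v t = left_value v a)"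
      using bspec[OF 1(1) aI] bspec[OF 1(2) aI] unfolding rule_def by simp
    then show ?thesis using idle1 idle2 1 by auto
  next
    case 2
    have "?rule \<longleftrightarrow> (\<forall>t\<in>{a..<b}. u t = left_value u a \<and>
        v t = running_max (left_value v a) (\<lambda>s. X s - left_value u a) a t)"
      using bspec[OF 2(1) aI] bspec[OF 2(2) aI] unfolding rule_def by simp
    then show ?thesis
      using idle1 active2 2 alone[OF v, of u "left_value u a"] by blast
  next
    case 3
    have "?rule \<longleftrightarrow> (\<forall>t\<in>{a..<b}. v t = left_value v a \<and>
        u t = running_max (left_value u a) (\<lambda>s. X s - left_value v a) a t)"
      using bspec[OF 3(1) aI] bspec[OF 3(2) aI] unfolding rule_def by simp
    then show ?thesis
      using idle2 active1 3 alone[OF u, of v "left_value v a"] by blast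
  next
    case 4
    have "?rule \<longleftrightarrow> (\<forall>t\<in>{a..<b}. u t + v t = running_max (left_value u a + left_value v a) X a t)"
      using bspec[OF 4(1) aI] bspec[OF 4(2) aI] unfolding rule_def by simp
    then show ?thesis
      using active1 active2 4 reflected_pair_iff_running_max[OF u v a X] by blast
  qed
qed

text \<open>
A nondecreasing path that follows the unfloored rule never falls below its value before \<open>a\<close>, so the
floor does not change what the rule prescribes.
\<close>

lemma recursion_rule_imp_floored:
  assumes u: "capacity_path u" and v: "capacity_path v" and a: "0 \<le> a"
    and "recursion_rule X g1 g2 a b (left_value u a) (left_value v a) u v"
  shows "floored_recursion_rule X g1 g2 a b (left_value u a) (left_value v a) u v"
proof -
  let ?p = "left_value u a" and ?q = "left_value v a"
  have le: "?p \<le> u t" "?q \<le> v t" if "t \<in> {a..<b}" for t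
    using that left_value_le[OF u a] left_value_le[OF v a] by auto
  have floor_u: "u t = max ?p S" if "t \<in> {a..<b}" "u t = S" for t S
    using le[OF that(1)] that(2) by simp
  have floor_v: "v t = max ?q S" if "t \<in> {a..<b}" "v t = S" for t S
    using le[OF that(1)] that(2) by simp
  have floor_sum: "u t + v t = max (?p + ?q) S" if "t \<in> {a..<b}" "u t + v t = S" for t S
    using le[OF that(1)] that(2) by simp
  note rule = assms(4)[unfolded recursion_rule_def]
  show ?thesis
    unfolding floored_recursion_rule_def
  proof (intro conjI)
    show "(\<forall>t\<in>{a..<b}. g1 t < 0 \<and> g2 t < 0) \<longrightarrow> (\<forall>t\<in>{a..<b}. u t = ?p \<and> v t = ?q)"
      using rule by (elim conjE)
    show "(\<forall>t\<in>{a..<b}. g1 t < 0 \<and> 0 \<le> g2 t) \<longrightarrow>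
        (\<forall>t\<in>{a..<b}. u t = ?p \<and> v t = max ?q (SUP s\<in>{a..t}. max 0 (X s - ?p)))"
      using conjunct1[OF conjunct2[OF rule]] floor_v by blast
    show "(\<forall>t\<in>{a..<b}. 0 \<le> g1 t \<and> g2 t < 0) \<longrightarrow>
        (\<forall>t\<in>{a..<b}. v t = ?q \<and> u t = max ?p (SUP s\<in>{a..t}. max 0 (X s - ?q)))"
      using conjunct1[OF conjunct2[OF conjunct2[OF rule]]] floor_u by blast
    show "(\<forall>t\<in>{a..<b}. 0 \<le> g1 t \<and> 0 \<le> g2 t) \<longrightarrow>
        (\<forall>t\<in>{a..<b}. u t + v t = max (?p + ?q) (SUP s\<in>{a..t}. max 0 (X s)))"
      using conjunct2[OF conjunct2[OF conjunct2[OF rule]]] floor_sum by blast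
  qed
qed

section \<open>Gluing the intervals of a partition\<close>

lemma partition_mono:
  fixes \<tau> :: "nat \<Rightarrow> real"
  assumes "\<forall>k<n. \<tau> k < \<tau> (Suc k)" "i \<le> j" "j \<le> n"
  shows "\<tau> i \<le> \<tau> j"
  using assms(2,3)
proof (induction j rule: dec_induct)
  case (step j)
  with assms(1)[rule_format, of j] show ?case by auto
qed simp

lemma partition_cover:
  fixes \<tau> :: "nat \<Rightarrow> real"
  assumes "\<tau> 0 \<le> t" "t < \<tau> m"
  shows "\<exists>k<m. t \<in> {\<tau> k..<\<tau> (Suc k)}"
  using assms(2)
proof (induction m)
  case (Suc m)
  show ?case
  proof (cases "t < \<tau> m")
    case True
    with Suc.IH show ?thesis by (auto intro: less_SucI)
  next
    case False
    with Suc.prems show ?thesis by auto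
  qed
qed (use assms(1) in simp)

text \<open>
An integral of a nonnegative measurable function vanishes iff the function is null almost everywhere,
and this property localizes to the pieces. Measurability of the obstacle is asked for on each piece
separately, where the indicator of a nonnegative margin is constant.
\<close>

lemma reflected_at_iff_pieces:
  assumes u: "capacity_path u" and \<tau>: "\<tau> 0 = 0" "\<tau> n = T" "\<forall>k<n. \<tau> k < \<tau> (Suc k)"
    and Y: "\<forall>k<n. Y \<in> borel_measurable (restrict_space borel {\<tau> k..<\<tau> (Suc k)})"
  shows "reflected_at T Y u \<longleftrightarrow> (\<forall>k<n. reflected_on (\<tau> k) (\<tau> (Suc k)) Y u)"
proof -
  have pieces: "{0..<T} = (\<Union>k<n. {\<tau> k..<\<tau> (Suc k)})"
  proof (intro set_eqI iffI)
    fix t assume "t \<in> {0..<T}"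
    then show "t \<in> (\<Union>k<n. {\<tau> k..<\<tau> (Suc k)})"
      using partition_cover[of \<tau> t n] \<tau> by auto
  next
    fix t assume "t \<in> (\<Union>k<n. {\<tau> k..<\<tau> (Suc k)})"
    then obtain k where "k < n" "t \<in> {\<tau> k..<\<tau> (Suc k)}" by auto
    then show "t \<in> {0..<T}"
      using partition_mono[OF \<tau>(3), of 0 k] partition_mono[OF \<tau>(3), of "Suc k" n] \<tau> by auto
  qed
  have "mono (zero_before u)"
    by (auto intro: monoI zero_before_mono[OF u])
  then have u_meas: "zero_before u \<in> borel_measurable borel"
    by (rule borel_measurable_mono)
  define f where "f t = ennreal (u t - Y t) * indicator {0..<T} t" for t
  have f: "f \<in> borel_measurable (stieltjes u)"
  proof (rule measurable_piecewise_restrict[where C = "insert (- {0..<T}) ((\<lambda>k. {\<tau> k..<\<tau> (Suc k)}) ` {..<n})"])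
    fix \<Omega> assume \<Omega>: "\<Omega> \<in> insert (- {0..<T}) ((\<lambda>k. {\<tau> k..<\<tau> (Suc k)}) ` {..<n})"
    then show "\<Omega> \<inter> space (stieltjes u) \<in> sets (stieltjes u)" by auto
    show "f \<in> borel_measurable (restrict_space (stieltjes u) \<Omega>)"
    proof (cases "\<Omega> = - {0..<T}")
      case True
      have "(\<lambda>_. 0 :: ennreal) \<in> borel_measurable (restrict_space (stieltjes u) \<Omega>)" by simp
      then show ?thesis
        by (rule measurable_cong[THEN iffD1, rotated])
          (auto simp: True space_restrict_space f_def)
    next
      case False
      with \<Omega> obtain k where k: "k < n" "\<Omega> = {\<tau> k..<\<tau> (Suc k)}" by auto
      have "(\<lambda>t. ennreal (zero_before u t - Y t)) \<in> borel_measurable (restrict_space borel \<Omega>)"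
        using Y k by (intro measurable_compose[OF _ measurable_ennreal] borel_measurable_diff
            measurable_restrict_space1[OF u_meas]) auto
      then have *: "(\<lambda>t. ennreal (zero_before u t - Y t)) \<in> borel_measurable (restrict_space (stieltjes u) \<Omega>)"
        by (subst measurable_cong_sets[OF sets_restrict_space_cong[OF sets_stieltjes] refl])
      show ?thesis
      proof (rule measurable_cong[THEN iffD1, OF _ *])
        fix t assume "t \<in> space (restrict_space (stieltjes u) \<Omega>)"
        then have "t \<in> {0..<T}" using k pieces by (auto simp: space_restrict_space)
        then show "ennreal (zero_before u t - Y t) = f t" by (simp add: f_def)
      qed
    qed
  qed (use pieces in auto)
  have "reflected_at T Y u \<longleftrightarrow>
      (\<forall>t\<in>{0..<T}. Y t \<le> u t) \<and> (AE t in stieltjes u. f t = 0)"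
    unfolding reflected_at_def nn_integral_0_iff_AE[OF f, symmetric] by (simp add: f_def[abs_def])
  also have "\<dots> \<longleftrightarrow> (\<forall>t\<in>{0..<T}. Y t \<le> u t) \<and>
      (AE t in stieltjes u. \<forall>k\<in>{..<n}. t \<in> {\<tau> k..<\<tau> (Suc k)} \<longrightarrow> u t = Y t)"
  proof (intro conj_cong refl AE_cong)
    fix t assume "\<forall>t\<in>{0..<T}. Y t \<le> u t"
    then have "f t = 0 \<longleftrightarrow> (t \<in> {0..<T} \<longrightarrow> u t = Y t)"
      by (auto simp: f_def indicator_def ennreal_eq_0_iff intro!: antisym)
    then show "f t = 0 \<longleftrightarrow> (\<forall>k\<in>{..<n}. t \<in> {\<tau> k..<\<tau> (Suc k)} \<longrightarrow> u t = Y t)"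
      unfolding pieces by auto
  qed
  also have "\<dots> \<longleftrightarrow> (\<forall>k<n. reflected_on (\<tau> k) (\<tau> (Suc k)) Y u)"
    unfolding pieces reflected_on_def by (subst AE_ball_countable) auto
  finally show ?thesis .
qed

lemma reflected_at_iff_floored_rule:
  assumes u: "capacity_path u" and v: "capacity_path v" and X: "continuous_on {0..T} X"
    and \<tau>: "\<tau> 0 = 0" "\<tau> n = T" "\<forall>k<n. \<tau> k < \<tau> (Suc k)"
    and signs: "\<And>k. k < n \<Longrightarrow>
      ((\<forall>t\<in>{\<tau> k..<\<tau> (Suc k)}. g1 t < 0) \<or> (\<forall>t\<in>{\<tau> k..<\<tau> (Suc k)}. 0 \<le> g1 t)) \<and>
      ((\<forall>t\<in>{\<tau> k..<\<tau> (Suc k)}. g2 t < 0) \<or> (\<forall>t\<in>{\<tau> k..<\<tau> (Suc k)}. 0 \<le> g2 t))"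
  shows "reflected_at T (\<lambda>t. (X t - v t) * indicator {0..} (g1 t)) u \<and>
      reflected_at T (\<lambda>t. (X t - u t) * indicator {0..} (g2 t)) v \<longleftrightarrow>
    (\<forall>k<n. floored_recursion_rule X g1 g2 (\<tau> k) (\<tau> (Suc k))
       (left_value u (\<tau> k)) (left_value v (\<tau> k)) u v)"
proof -
  have bounds: "0 \<le> \<tau> k" "\<tau> (Suc k) \<le> T" if "k < n" for k
    using partition_mono[OF \<tau>(3), of 0 k] partition_mono[OF \<tau>(3), of "Suc k" n] \<tau> that by auto
  have X_piece: "continuous_on {\<tau> k..<\<tau> (Suc k)} X" if "k < n" for k
    by (rule continuous_on_subset[OF X]) (use bounds[OF that] in auto)
  have meas: "(\<lambda>t. (X t - w t) * indicator {0..} (g t))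
      \<in> borel_measurable (restrict_space borel {\<tau> k..<\<tau> (Suc k)})"
    if "k < n" and w: "capacity_path w"
      and g: "(\<forall>t\<in>{\<tau> k..<\<tau> (Suc k)}. g t < 0) \<or> (\<forall>t\<in>{\<tau> k..<\<tau> (Suc k)}. 0 \<le> g t)"
    for k w and g :: "real \<Rightarrow> real"
  proof -
    let ?R = "restrict_space borel {\<tau> k..<\<tau> (Suc k)}"
    have "mono (zero_before w)"
      by (auto intro: monoI zero_before_mono[OF w])
    then have w_meas: "zero_before w \<in> borel_measurable ?R"
      by (intro measurable_restrict_space1 borel_measurable_mono)
    have X_meas: "X \<in> borel_measurable ?R"
      by (rule borel_measurable_continuous_on_restrict[OF X_piece[OF \<open>k < n\<close>]])
    \<comment> \<open>On this piece the indicator is constant, although \<open>g\<close> itself may be nonmeasurable.\<close>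
    define c :: real where "c = (if \<forall>t\<in>{\<tau> k..<\<tau> (Suc k)}. g t < 0 then 0 else 1)"
    have *: "(\<lambda>t. (X t - zero_before w t) * c) \<in> borel_measurable ?R"
      using w_meas X_meas by measurable
    have sign: "indicator {0..} (g t) = c" if "t \<in> {\<tau> k..<\<tau> (Suc k)}" for t
      using g
    proof
      assume "\<forall>t\<in>{\<tau> k..<\<tau> (Suc k)}. g t < 0"
      with bspec[OF this that] show ?thesis by (simp add: c_def)
    next
      assume "\<forall>t\<in>{\<tau> k..<\<tau> (Suc k)}. 0 \<le> g t"
      with bspec[OF this that] that show ?thesis by (auto simp: c_def not_less)
    qed
    show ?thesis
      by (rule measurable_cong[THEN iffD1, OF _ *])
        (use sign bounds[OF \<open>k < n\<close>] in \<open>auto simp: space_restrict_space\<close>)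
  qed
  have "reflected_at T (\<lambda>t. (X t - v t) * indicator {0..} (g1 t)) u \<longleftrightarrow>
      (\<forall>k<n. reflected_on (\<tau> k) (\<tau> (Suc k)) (\<lambda>t. (X t - v t) * indicator {0..} (g1 t)) u)"
    using signs by (intro reflected_at_iff_pieces[OF u \<tau>] allI impI meas v) auto
  moreover have "reflected_at T (\<lambda>t. (X t - u t) * indicator {0..} (g2 t)) v \<longleftrightarrow>
      (\<forall>k<n. reflected_on (\<tau> k) (\<tau> (Suc k)) (\<lambda>t. (X t - u t) * indicator {0..} (g2 t)) v)"
    using signs by (intro reflected_at_iff_pieces[OF v \<tau>] allI impI meas u) auto
  moreover have "reflected_on (\<tau> k) (\<tau> (Suc k)) (\<lambda>t. (X t - v t) * indicator {0..} (g1 t)) u \<and>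
      reflected_on (\<tau> k) (\<tau> (Suc k)) (\<lambda>t. (X t - u t) * indicator {0..} (g2 t)) v \<longleftrightarrow>
      floored_recursion_rule X g1 g2 (\<tau> k) (\<tau> (Suc k))
        (left_value u (\<tau> k)) (left_value v (\<tau> k)) u v" if "k < n" for k
    using bounds[OF that] X_piece[OF that] \<tau>(3) signs[OF that] that
    by (intro reflected_on_iff_floored_rule u v) auto
  ultimately show ?thesis by blast
qed

section \<open>Continuing controls along a running maximum\<close>

text \<open>
From time \<open>b\<close> on the path is frozen, so that \<open>Z\<close> matters on \<open>[a, b]\<close> only.
\<close>

lemma capacity_path_continue:
  assumes u: "capacity_path u" and a: "0 \<le> a" "a < b" and Z: "continuous_on {a..b} Z"
  shows "capacity_path (\<lambda>t. if t < a then u t else running_max (left_value u a) Z a (min t b))"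
    (is "capacity_path ?w")
proof -
  let ?q = "left_value u a"
  have q: "0 \<le> ?q" by (rule left_value_nonneg[OF u])
  have Zs: "continuous_on {a..s} Z" if "s \<le> b" for s
    by (rule continuous_on_subset[OF Z]) (use that in auto)
  have ge: "?q \<le> running_max ?q Z a (min t b)" if "a \<le> t" for t
    using running_max_upper(1)[OF q _ Zs, of "min t b"] that a by auto
  have "0 \<le> ?w 0"
    using ge[of 0] q capacity_path_nonneg[OF u, of 0] by auto
  moreover have "mono_on {0..} ?w"
  proof (rule mono_onI)
    fix s t :: real assume st: "s \<in> {0..}" "t \<in> {0..}" "s \<le> t"
    consider "t < a" | "s < a" "a \<le> t" | "a \<le> s" by linarith
    then show "?w s \<le> ?w t"
    proof cases
      case 1
      then show ?thesis using st capacity_path_mono[OF u, of s t] by auto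
    next
      case 2
      then show ?thesis
        using zero_before_le_left_value[OF u, of s a] ge[of t] st by auto
    next
      case 3
      then show ?thesis
        using running_max_mono[OF q _ _ Zs, of "min s b" "min t b"] st a by auto
    qed
  qed
  moreover have "continuous (at_right t) ?w" if "0 \<le> t" for t
  proof -
    consider "t < a" | "a \<le> t" "t < b" | "b \<le> t" by linarith
    then have "(?w \<longlongrightarrow> ?w t) (at_right t)"
    proof cases
      case 1
      have "(u \<longlongrightarrow> u t) (at_right t)"
        using u that by (auto simp: capacity_path_def continuous_within)
      moreover have "\<forall>\<^sub>F s in at_right t. u s = ?w s"
        unfolding eventually_at_right_field using 1 by (intro exI[of _ a]) auto
      ultimately show ?thesis
        using 1 by (auto intro: Lim_transform_eventually)
    next
      case 2
      have "\<forall>\<^sub>F s in at_right t. running_max ?q Z a s = ?w s"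
        unfolding eventually_at_right_field using 2 by (intro exI[of _ b]) auto
      with running_max_right_continuous[OF q 2 Z]
      show ?thesis
        using 2 by (auto intro: Lim_transform_eventually)
    next
      case 3
      have "\<forall>\<^sub>F s in at_right t. running_max ?q Z a b = ?w s"
        unfolding eventually_at_right_field using 3 a by (intro exI[of _ "t + 1"]) auto
      then have "(?w \<longlongrightarrow> running_max ?q Z a b) (at_right t)"
        by (rule Lim_transform_eventually[OF tendsto_const])
      then show ?thesis using 3 a by auto
    qed
    then show ?thesis by (simp add: continuous_within)
  qed
  ultimately show ?thesis by (simp add: capacity_path_def)
qed

lemma admissible_iff:
  "\<xi> \<in> admissible M F \<longleftrightarrow>
     (\<forall>t\<ge>0. \<xi> t \<in> borel_measurable (F t)) \<and> (\<forall>\<omega>\<in>space M. capacity_path (\<lambda>t. \<xi> t \<omega>))"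
  by (simp add: admissible_def capacity_path_def)

lemma floored_recursion_rule_cong:
  assumes "\<And>t. t \<in> {a..<b} \<Longrightarrow> u t = u' t" "\<And>t. t \<in> {a..<b} \<Longrightarrow> v t = v' t"
  shows "floored_recursion_rule X g1 g2 a b p q u v \<longleftrightarrow>
    floored_recursion_rule X g1 g2 a b p q u' v'"
  using assms unfolding floored_recursion_rule_def by simp

text \<open>
The Boolean \<open>d\<close> decides who builds when both margins are nonnegative: company 1 if it is true,
company 2 otherwise. Multiplying the obstacle by 0 turns the running maximum into the constant
\<open>p\<close> or \<open>q\<close>, so a single formula covers builders and idle companies.
\<close>

lemma floored_rule_one_builder:
  assumes p: "0 \<le> p" and q: "0 \<le> q" and ab: "a < b" and X: "continuous_on {a..<b} X"
    and g1: "(\<forall>t\<in>{a..<b}. g1 t < 0) \<or> (\<forall>t\<in>{a..<b}. 0 \<le> g1 t)"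
    and g2: "(\<forall>t\<in>{a..<b}. g2 t < 0) \<or> (\<forall>t\<in>{a..<b}. 0 \<le> g2 t)"
    and e1: "e1 = of_bool (0 \<le> g1 a \<and> (d \<or> g2 a < 0))"
    and e2: "e2 = of_bool (0 \<le> g2 a \<and> (\<not> d \<or> g1 a < 0))"
    and u: "\<And>t. t \<in> {a..<b} \<Longrightarrow> u t = running_max p (\<lambda>s. (X s - q) * e1) a t"
    and v: "\<And>t. t \<in> {a..<b} \<Longrightarrow> v t = running_max q (\<lambda>s. (X s - p) * e2) a t"
  shows "floored_recursion_rule X g1 g2 a b p q u v"
proof -
  note signs = sign_pattern_iff_at_start[OF ab g1 g2]
  have shift: "running_max p (\<lambda>s. X s - q) a t + q = running_max (p + q) X a t"
    "running_max q (\<lambda>s. X s - p) a t + p = running_max (p + q) X a t" if "t \<in> {a..<b}" for t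
  proof -
    have "continuous_on {a..t} X"
      by (rule continuous_on_subset[OF X]) (use that in auto)
    then show "running_max p (\<lambda>s. X s - q) a t + q = running_max (p + q) X a t"
      "running_max q (\<lambda>s. X s - p) a t + p = running_max (p + q) X a t"
      using running_max_shift[OF p q, of a t X] running_max_shift[OF q p, of a t X] that
      by (auto simp: add.commute)
  qed
  show ?thesis
    unfolding floored_recursion_rule_def signs running_max_def[symmetric]
    using shift by (auto simp: u v e1 e2 running_max_zero[OF p] running_max_zero[OF q] add.commute)
qed

lemma filtration_measurable_mono:
  assumes "filtration \<Omega> F" "f \<in> borel_measurable (F s)" "s \<le> t"
  shows "f \<in> borel_measurable (F t)"
proof -
  interpret filtration \<Omega> F by fact
  show ?thesis
    using measurable_mono[OF order_refl refl sets_F_mono[OF assms(3)]] assms(2)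
    by (auto simp: space_F)
qed

lemma borel_measurable_left_value:
  assumes "filtration (space M) F" "\<xi> \<in> admissible M F" "0 \<le> a"
  shows "(\<lambda>\<omega>. left_value (\<lambda>t. \<xi> t \<omega>) a) \<in> borel_measurable (F a)"
proof -
  interpret filtration "space M" F by fact
  define r where "r i = a - 1 / real (Suc i)" for i
  have r: "r i < a" for i by (simp add: r_def)
  have r_lim: "filterlim r (at_left a) sequentially"
    unfolding filterlim_at r_def
    using tendsto_diff[OF tendsto_const[of a] LIMSEQ_inverse_real_of_nat]
    by (auto simp: inverse_eq_divide)
  show ?thesis
  proof (rule borel_measurable_LIMSEQ_real)
    show "(\<lambda>i. zero_before (\<lambda>t. \<xi> t \<omega>) (r i)) \<longlonglongrightarrow> left_value (\<lambda>t. \<xi> t \<omega>) a"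
      if "\<omega> \<in> space (F a)" for \<omega>
      using that assms(2)
      by (intro filterlim_compose[OF tendsto_left_value r_lim]) (auto simp: admissible_iff space_F)
    show "(\<lambda>\<omega>. zero_before (\<lambda>t. \<xi> t \<omega>) (r i)) \<in> borel_measurable (F a)" for i
    proof (cases "r i < 0")
      case False
      then have "\<xi> (r i) \<in> borel_measurable (F (r i))"
        using assms(2) by (auto simp: admissible_iff)
      then have "\<xi> (r i) \<in> borel_measurable (F a)"
        by (rule filtration_measurable_mono[OF assms(1)]) (use r[of i] in simp)
      then show ?thesis using False by (simp add: zero_before_def)
    qed (simp add: zero_before_def)
  qed
qed

text \<open>
A company that waits after time \<open>a\<close> is the case of the obstacle \<open>Z = 0\<close>.
\<close>

definition continue :: "real \<Rightarrow> real \<Rightarrow> (real \<Rightarrow> 'a \<Rightarrow> real) \<Rightarrow> (real \<Rightarrow> 'a \<Rightarrow> real) \<Rightarrow> real \<Rightarrow> 'a \<Rightarrow> real" where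
  "continue a b Z \<xi> t \<omega> =
     (if t < a then \<xi> t \<omega>
      else running_max (left_value (\<lambda>s. \<xi> s \<omega>) a) (\<lambda>s. Z s \<omega>) a (min t b))"

lemma admissible_continue:
  assumes filt: "filtration (space M) F" and \<xi>: "\<xi> \<in> admissible M F" and a: "0 \<le> a" "a < b"
    and Z_adapted: "\<And>t. t \<in> {a..b} \<Longrightarrow> Z t \<in> borel_measurable (F t)"
    and Z_cont: "\<And>\<omega>. \<omega> \<in> space M \<Longrightarrow> continuous_on {a..b} (\<lambda>t. Z t \<omega>)"
  shows "continue a b Z \<xi> \<in> admissible M F"
proof -
  interpret filtration "space M" F by fact
  note later = filtration_measurable_mono[OF filt]
  have "continue a b Z \<xi> t \<in> borel_measurable (F t)" if "0 \<le> t" for t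
  proof (cases "t < a")
    case True
    have "continue a b Z \<xi> t = \<xi> t" using True by (auto simp: continue_def)
    then show ?thesis using \<xi> that by (simp add: admissible_iff)
  next
    case False
    have "(\<lambda>\<omega>. running_max (left_value (\<lambda>s. \<xi> s \<omega>) a) (\<lambda>s. Z s \<omega>) a (min t b)) \<in> borel_measurable (F t)"
    proof (rule borel_measurable_running_max)
      show "(\<lambda>\<omega>. left_value (\<lambda>s. \<xi> s \<omega>) a) \<in> borel_measurable (F t)"
        by (rule later[OF borel_measurable_left_value[OF filt \<xi> a(1)]]) (use False in simp)
      show "Z s \<in> borel_measurable (F t)" if "s \<in> {a..min t b}" for s
        using that by (intro later[OF Z_adapted]) auto
      show "continuous_on {a..min t b} (\<lambda>s. Z s \<omega>)" if "\<omega> \<in> space (F t)" for \<omega>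
        using that by (intro continuous_on_subset[OF Z_cont]) (auto simp: space_F)
    qed (use False a in auto)
    then show ?thesis using False by (simp add: continue_def[abs_def])
  qed
  moreover have "capacity_path (\<lambda>t. continue a b Z \<xi> t \<omega>)" if "\<omega> \<in> space M" for \<omega>
    unfolding continue_def
    using \<xi> that by (intro capacity_path_continue a Z_cont) (auto simp: admissible_iff)
  ultimately show ?thesis by (simp add: admissible_iff)
qed

section \<open>Solutions of the coupled Skorohod problem\<close>

locale capacity_game =
  fixes M :: "'a measure" and F :: "real \<Rightarrow> 'a measure" and T :: real
    and \<pi> h1 h2 X :: "real \<Rightarrow> 'a \<Rightarrow> real" and n :: nat and \<tau> :: "nat \<Rightarrow> real"
  assumes filt: "filtration (space M) F"
    and \<pi>_adapted: "t \<in> {0..T} \<Longrightarrow> \<pi> t \<in> borel_measurable (F t)"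
    and h1_adapted: "t \<in> {0..T} \<Longrightarrow> h1 t \<in> borel_measurable (F t)"
    and h2_adapted: "t \<in> {0..T} \<Longrightarrow> h2 t \<in> borel_measurable (F t)"
    and X_adapted: "t \<in> {0..T} \<Longrightarrow> X t \<in> borel_measurable (F t)"
    and X_cont: "\<omega> \<in> space M \<Longrightarrow> continuous_on {0..T} (\<lambda>t. X t \<omega>)"
    and \<tau>: "\<tau> 0 = 0" "\<tau> n = T" "\<forall>k<n. \<tau> k < \<tau> (Suc k)"
    and signs: "AE \<omega> in M. \<forall>k<n.
      ((\<forall>t\<in>{\<tau> k..<\<tau> (Suc k)}. \<pi> t \<omega> + h1 t \<omega> < 0) \<or>
       (\<forall>t\<in>{\<tau> k..<\<tau> (Suc k)}. 0 \<le> \<pi> t \<omega> + h1 t \<omega>)) \<and>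
      ((\<forall>t\<in>{\<tau> k..<\<tau> (Suc k)}. \<pi> t \<omega> + h2 t \<omega> < 0) \<or>
       (\<forall>t\<in>{\<tau> k..<\<tau> (Suc k)}. 0 \<le> \<pi> t \<omega> + h2 t \<omega>))"
begin

abbreviation floored_until :: "nat \<Rightarrow> (real \<Rightarrow> 'a \<Rightarrow> real) \<Rightarrow> (real \<Rightarrow> 'a \<Rightarrow> real) \<Rightarrow> bool" where
  "floored_until m \<equiv> follows floored_recursion_rule M m \<tau> \<pi> h1 h2 X"

abbreviation solution :: "(real \<Rightarrow> 'a \<Rightarrow> real) \<Rightarrow> (real \<Rightarrow> 'a \<Rightarrow> real) \<Rightarrow> bool" where
  "solution \<equiv> skorohod_solution M F T \<pi> h1 h2 X"

lemma \<tau>_bounds: "k < n \<Longrightarrow> 0 \<le> \<tau> k" "k < n \<Longrightarrow> \<tau> k < \<tau> (Suc k)" "k < n \<Longrightarrow> \<tau> (Suc k) \<le> T"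
  using partition_mono[OF \<tau>(3), of 0 k] partition_mono[OF \<tau>(3), of "Suc k" n] \<tau> by auto

lemma capacity_pathD: "\<xi> \<in> admissible M F \<Longrightarrow> \<omega> \<in> space M \<Longrightarrow> capacity_path (\<lambda>t. \<xi> t \<omega>)"
  by (simp add: admissible_iff)

lemma solution_iff_floored:
  assumes \<xi>: "\<xi>1 \<in> admissible M F" "\<xi>2 \<in> admissible M F"
  shows "solution \<xi>1 \<xi>2 \<longleftrightarrow> floored_until n \<xi>1 \<xi>2"
proof -
  have "AE \<omega> in M.
      (reflected_at T (\<lambda>t. (X t \<omega> - \<xi>2 t \<omega>) * indicator {0..} (\<pi> t \<omega> + h1 t \<omega>)) (\<lambda>t. \<xi>1 t \<omega>) \<and>
       reflected_at T (\<lambda>t. (X t \<omega> - \<xi>1 t \<omega>) * indicator {0..} (\<pi> t \<omega> + h2 t \<omega>)) (\<lambda>t. \<xi>2 t \<omega>)) \<longleftrightarrow>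
      (\<forall>k<n. floored_recursion_rule (\<lambda>t. X t \<omega>) (\<lambda>t. \<pi> t \<omega> + h1 t \<omega>) (\<lambda>t. \<pi> t \<omega> + h2 t \<omega>)
         (\<tau> k) (\<tau> (Suc k)) (left_value (\<lambda>t. \<xi>1 t \<omega>) (\<tau> k)) (left_value (\<lambda>t. \<xi>2 t \<omega>) (\<tau> k))
         (\<lambda>t. \<xi>1 t \<omega>) (\<lambda>t. \<xi>2 t \<omega>))"
    using signs AE_space
  proof eventually_elim
    case (elim \<omega>)
    show ?case
      by (rule reflected_at_iff_floored_rule[OF capacity_pathD[OF \<xi>(1)] capacity_pathD[OF \<xi>(2)] X_cont \<tau>])
        (use elim in blast)+
  qed
  from eventually_subst[OF this] show ?thesis
    using \<xi> by (simp add: skorohod_solution_def follows_def)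
qed

lemma recursion_imp_floored:
  assumes \<xi>: "\<xi>1 \<in> admissible M F" "\<xi>2 \<in> admissible M F"
    and "follows recursion_rule M n \<tau> \<pi> h1 h2 X \<xi>1 \<xi>2"
  shows "floored_until n \<xi>1 \<xi>2"
  using assms(3) AE_space unfolding follows_def
proof eventually_elim
  case (elim \<omega>)
  show ?case
    using elim \<tau>_bounds(1)
    by (auto intro!: recursion_rule_imp_floored capacity_pathD \<xi>)
qed

text \<open>
Who builds on \<open>[\<tau> k, \<tau> (k+1))\<close> is decided by the margins at \<open>\<tau> k\<close>, which are known at that time; this
keeps the continuation adapted. Where the signs are constant on the interval, the decision is
the one that the rule prescribes. The last conclusion records how the choice of \<open>d\<close> shows in the
capacity of company 1, and serves to tell the two continuations apart.
\<close>

lemma extend_one_interval: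
  assumes k: "k < n" and \<xi>: "\<xi>1 \<in> admissible M F" "\<xi>2 \<in> admissible M F"
    and floored: "floored_until k \<xi>1 \<xi>2"
  obtains \<eta>1 \<eta>2 where "\<eta>1 \<in> admissible M F" "\<eta>2 \<in> admissible M F"
    "floored_until (Suc k) \<eta>1 \<eta>2"
    "\<And>t \<omega>. t < \<tau> k \<Longrightarrow> \<eta>1 t \<omega> = \<xi>1 t \<omega> \<and> \<eta>2 t \<omega> = \<xi>2 t \<omega>"
    "\<And>t \<omega>. t \<in> {\<tau> k..<\<tau> (Suc k)} \<Longrightarrow>
       0 \<le> \<pi> (\<tau> k) \<omega> + h1 (\<tau> k) \<omega> \<Longrightarrow> 0 \<le> \<pi> (\<tau> k) \<omega> + h2 (\<tau> k) \<omega> \<Longrightarrow> \<omega> \<in> space M \<Longrightarrow>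
       \<eta>1 t \<omega> = (if d then running_max (left_value (\<lambda>s. \<xi>1 s \<omega>) (\<tau> k))
           (\<lambda>s. X s \<omega> - left_value (\<lambda>s. \<xi>2 s \<omega>) (\<tau> k)) (\<tau> k) t
         else left_value (\<lambda>s. \<xi>1 s \<omega>) (\<tau> k))"
proof -
  define a b where "a = \<tau> k" and "b = \<tau> (Suc k)"
  have ab: "0 \<le> a" "a < b" "b \<le> T" using \<tau>_bounds[OF k] by (auto simp: a_def b_def)
  define p q where "p \<omega> = left_value (\<lambda>s. \<xi>1 s \<omega>) a" and "q \<omega> = left_value (\<lambda>s. \<xi>2 s \<omega>) a" for \<omega>
  define e1 :: "'a \<Rightarrow> real" where
    "e1 \<omega> = of_bool (0 \<le> \<pi> a \<omega> + h1 a \<omega> \<and> (d \<or> \<pi> a \<omega> + h2 a \<omega> < 0))" for \<omega>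
  define e2 :: "'a \<Rightarrow> real" where
    "e2 \<omega> = of_bool (0 \<le> \<pi> a \<omega> + h2 a \<omega> \<and> (\<not> d \<or> \<pi> a \<omega> + h1 a \<omega> < 0))" for \<omega>
  define Z1 Z2 where "Z1 t \<omega> = (X t \<omega> - q \<omega>) * e1 \<omega>" and "Z2 t \<omega> = (X t \<omega> - p \<omega>) * e2 \<omega>" for t \<omega>
  define \<eta>1 \<eta>2 where "\<eta>1 = continue a b Z1 \<xi>1" and "\<eta>2 = continue a b Z2 \<xi>2"
  note later = filtration_measurable_mono[OF filt]
  have [measurable]: "\<pi> a \<in> borel_measurable (F a)" "h1 a \<in> borel_measurable (F a)"
      "h2 a \<in> borel_measurable (F a)"
    using \<pi>_adapted h1_adapted h2_adapted ab by auto
  have pq: "p \<in> borel_measurable (F a)" "q \<in> borel_measurable (F a)"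
    unfolding p_def[abs_def] q_def[abs_def]
    using borel_measurable_left_value[OF filt _ ab(1)] \<xi> by auto
  have e: "e1 \<in> borel_measurable (F a)" "e2 \<in> borel_measurable (F a)"
    unfolding e1_def[abs_def] e2_def[abs_def] of_bool_def by measurable
  have Z_adapted: "Z1 t \<in> borel_measurable (F t)" "Z2 t \<in> borel_measurable (F t)" if "t \<in> {a..b}" for t
  proof -
    have "a \<le> t" "t \<in> {0..T}" using that ab by auto
    then show "Z1 t \<in> borel_measurable (F t)" "Z2 t \<in> borel_measurable (F t)"
      unfolding Z1_def[abs_def] Z2_def[abs_def]
      by (intro borel_measurable_times borel_measurable_diff X_adapted later[OF pq(1)]
          later[OF pq(2)] later[OF e(1)] later[OF e(2)]; simp)+
  qed
  have X_ab: "continuous_on {a..b} (\<lambda>t. X t \<omega>)" if "\<omega> \<in> space M" for \<omega>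
    by (rule continuous_on_subset[OF X_cont[OF that]]) (use ab in auto)
  have Z_cont: "continuous_on {a..b} (\<lambda>t. Z1 t \<omega>)" "continuous_on {a..b} (\<lambda>t. Z2 t \<omega>)"
    if "\<omega> \<in> space M" for \<omega>
    unfolding Z1_def Z2_def by (intro continuous_intros X_ab that)+
  have adm: "\<eta>1 \<in> admissible M F" "\<eta>2 \<in> admissible M F"
    unfolding \<eta>1_def \<eta>2_def
    by (intro admissible_continue[OF filt] \<xi> ab Z_adapted Z_cont; assumption)+
  have before: "\<eta>1 t \<omega> = \<xi>1 t \<omega> \<and> \<eta>2 t \<omega> = \<xi>2 t \<omega>" if "t < a" for t \<omega>
    using that by (simp add: \<eta>1_def \<eta>2_def continue_def)
  have on: "\<eta>1 t \<omega> = running_max (p \<omega>) (\<lambda>s. (X s \<omega> - q \<omega>) * e1 \<omega>) a t"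
    "\<eta>2 t \<omega> = running_max (q \<omega>) (\<lambda>s. (X s \<omega> - p \<omega>) * e2 \<omega>) a t" if "t \<in> {a..<b}" for t \<omega>
    using that by (simp_all add: \<eta>1_def \<eta>2_def continue_def Z1_def Z2_def p_def q_def min_def)
  have nonneg: "0 \<le> p \<omega>" "0 \<le> q \<omega>" if "\<omega> \<in> space M" for \<omega>
    unfolding p_def q_def by (intro left_value_nonneg capacity_pathD \<xi> that)+
  have same_left: "left_value (\<lambda>t. \<eta>1 t \<omega>) s = left_value (\<lambda>t. \<xi>1 t \<omega>) s"
      "left_value (\<lambda>t. \<eta>2 t \<omega>) s = left_value (\<lambda>t. \<xi>2 t \<omega>) s" if "s \<le> a" for s \<omega>
    by (rule left_value_cong; use before that in auto)+
  have "floored_until (Suc k) \<eta>1 \<eta>2"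
    using signs AE_space floored unfolding follows_def
  proof eventually_elim
    case (elim \<omega>)
    let ?rule = "\<lambda>j. floored_recursion_rule (\<lambda>t. X t \<omega>) (\<lambda>t. \<pi> t \<omega> + h1 t \<omega>) (\<lambda>t. \<pi> t \<omega> + h2 t \<omega>)
      (\<tau> j) (\<tau> (Suc j))"
    have "?rule k (p \<omega>) (q \<omega>) (\<lambda>t. \<eta>1 t \<omega>) (\<lambda>t. \<eta>2 t \<omega>)"
      unfolding a_def[symmetric] b_def[symmetric]
    proof (rule floored_rule_one_builder[where d = d and p = "p \<omega>" and q = "q \<omega>" and
          X = "\<lambda>t. X t \<omega>" and ?g1.0 = "\<lambda>t. \<pi> t \<omega> + h1 t \<omega>" and ?g2.0 = "\<lambda>t. \<pi> t \<omega> + h2 t \<omega>",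
          OF nonneg[OF elim(2)] ab(2) _ _ _ e1_def[of \<omega>] e2_def[of \<omega>] on])
      show "continuous_on {a..<b} (\<lambda>t. X t \<omega>)"
        by (rule continuous_on_subset[OF X_ab[OF elim(2)]]) auto
    qed (use elim(1)[rule_format, OF k] in \<open>simp_all only: a_def b_def\<close>)
    moreover have "?rule j (left_value (\<lambda>t. \<xi>1 t \<omega>) (\<tau> j)) (left_value (\<lambda>t. \<xi>2 t \<omega>) (\<tau> j))
        (\<lambda>t. \<eta>1 t \<omega>) (\<lambda>t. \<eta>2 t \<omega>)" if "j < k" for j
    proof (subst floored_recursion_rule_cong)
      have "\<tau> (Suc j) \<le> a"
        unfolding a_def by (rule partition_mono[OF \<tau>(3)]) (use that k in auto)
      then show "\<eta>1 t \<omega> = \<xi>1 t \<omega>" "\<eta>2 t \<omega> = \<xi>2 t \<omega>" if "t \<in> {\<tau> j..<\<tau> (Suc j)}" for t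
        using that before[of t \<omega>] by auto
      show "?rule j (left_value (\<lambda>t. \<xi>1 t \<omega>) (\<tau> j)) (left_value (\<lambda>t. \<xi>2 t \<omega>) (\<tau> j))
        (\<lambda>t. \<xi>1 t \<omega>) (\<lambda>t. \<xi>2 t \<omega>)"
        using elim(3) that by blast
    qed
    moreover have "\<tau> j \<le> a" if "j \<le> k" for j
      unfolding a_def by (rule partition_mono[OF \<tau>(3)]) (use that k in auto)
    ultimately show ?case
      by (auto simp: less_Suc_eq same_left p_def q_def a_def)
  qed
  moreover have "\<eta>1 t \<omega> = (if d then running_max (p \<omega>) (\<lambda>s. X s \<omega> - q \<omega>) a t else p \<omega>)"
    if "t \<in> {a..<b}" "0 \<le> \<pi> a \<omega> + h1 a \<omega>" "0 \<le> \<pi> a \<omega> + h2 a \<omega>" "\<omega> \<in> space M" for t \<omega>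
    using that by (auto simp: on e1_def running_max_zero nonneg)
  ultimately show thesis
    using that adm before unfolding a_def b_def p_def q_def by blast
qed

lemma extend_to_horizon:
  assumes "m \<le> n" "\<xi>1 \<in> admissible M F" "\<xi>2 \<in> admissible M F" "floored_until m \<xi>1 \<xi>2"
  shows "\<exists>\<eta>1 \<eta>2. solution \<eta>1 \<eta>2 \<and>
    (\<forall>t \<omega>. t < \<tau> m \<longrightarrow> \<eta>1 t \<omega> = \<xi>1 t \<omega> \<and> \<eta>2 t \<omega> = \<xi>2 t \<omega>)"
  using assms
proof (induction m arbitrary: \<xi>1 \<xi>2 rule: inc_induct)
  case base
  then show ?case using solution_iff_floored by blast
next
  case (step m)
  obtain \<zeta>1 \<zeta>2 where \<zeta>: "\<zeta>1 \<in> admissible M F" "\<zeta>2 \<in> admissible M F" "floored_until (Suc m) \<zeta>1 \<zeta>2"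
      and agree: "\<And>t \<omega>. t < \<tau> m \<Longrightarrow> \<zeta>1 t \<omega> = \<xi>1 t \<omega> \<and> \<zeta>2 t \<omega> = \<xi>2 t \<omega>"
    by (rule extend_one_interval[OF step.hyps(2) step.prems, where d = True]) (rule that; assumption)
  obtain \<eta>1 \<eta>2 where "solution \<eta>1 \<eta>2"
      and "\<And>t \<omega>. t < \<tau> (Suc m) \<Longrightarrow> \<eta>1 t \<omega> = \<zeta>1 t \<omega> \<and> \<eta>2 t \<omega> = \<zeta>2 t \<omega>"
    using step.IH[OF \<zeta>] by blast
  moreover have "t < \<tau> (Suc m)" if "t < \<tau> m" for t
    using that \<tau>_bounds(2)[OF step.hyps(2)] by simp
  ultimately show ?case
    using agree by (intro exI[of _ \<eta>1] exI[of _ \<eta>2]) simp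
qed

lemma solution_exists: "\<exists>\<xi>1 \<xi>2. solution \<xi>1 \<xi>2"
proof -
  have "(\<lambda>_ _. 0) \<in> admissible M F"
    by (simp add: admissible_iff capacity_path_zero)
  moreover have "floored_until 0 (\<lambda>_ _. 0) (\<lambda>_ _. 0)"
    by (simp add: follows_def)
  ultimately show ?thesis
    using extend_to_horizon[of 0 "\<lambda>_ _. 0" "\<lambda>_ _. 0"] by blast
qed

text \<open>
Two continuations of \<open>(\<xi>1, \<xi>2)\<close> beyond \<open>\<tau> k\<close> are compared, one in which company 1 builds and one in
which company 2 does. If both agreed with \<open>\<xi>1\<close> almost surely, then the running maximum of
\<open>X - \<xi>2(\<tau> k-)\<close> floored at \<open>\<xi>1(\<tau> k-)\<close> would never leave its floor, so that demand would not exceed the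
installed capacity on this interval.
\<close>

lemma another_solution:
  assumes k: "k < n" and sol: "solution \<xi>1 \<xi>2"
    and both: "AE \<omega> in M. \<forall>t\<in>{\<tau> k..<\<tau> (Suc k)}. 0 \<le> \<pi> t \<omega> + h1 t \<omega> \<and> 0 \<le> \<pi> t \<omega> + h2 t \<omega>"
    and short: "\<not> (AE \<omega> in M. \<forall>t\<in>{\<tau> k..<\<tau> (Suc k)}.
      X t \<omega> \<le> left_value (\<lambda>s. \<xi>1 s \<omega>) (\<tau> k) + left_value (\<lambda>s. \<xi>2 s \<omega>) (\<tau> k))"
  shows "\<exists>\<eta>1 \<eta>2. solution \<eta>1 \<eta>2 \<and> \<not> same_on M T \<xi>1 \<eta>1"
proof (rule ccontr)
  assume unique: "\<nexists>\<eta>1 \<eta>2. solution \<eta>1 \<eta>2 \<and> \<not> same_on M T \<xi>1 \<eta>1"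
  let ?p = "\<lambda>\<omega>. left_value (\<lambda>s. \<xi>1 s \<omega>) (\<tau> k)" and ?q = "\<lambda>\<omega>. left_value (\<lambda>s. \<xi>2 s \<omega>) (\<tau> k)"
  have \<xi>: "\<xi>1 \<in> admissible M F" "\<xi>2 \<in> admissible M F"
    using sol by (auto simp: skorohod_solution_def)
  have "floored_until n \<xi>1 \<xi>2" using sol solution_iff_floored[OF \<xi>] by simp
  then have "floored_until k \<xi>1 \<xi>2"
    unfolding follows_def by eventually_elim (use k in auto)
  note extend = extend_one_interval[OF k \<xi> this]
  have forced: "AE \<omega> in M. \<forall>t\<in>{\<tau> k..<\<tau> (Suc k)}. \<xi>1 t \<omega> =
      (if d then running_max (?p \<omega>) (\<lambda>s. X s \<omega> - ?q \<omega>) (\<tau> k) t else ?p \<omega>)" for d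
  proof -
    obtain \<zeta>1 \<zeta>2 where \<zeta>: "\<zeta>1 \<in> admissible M F" "\<zeta>2 \<in> admissible M F" "floored_until (Suc k) \<zeta>1 \<zeta>2"
      and on: "\<And>t \<omega>. t \<in> {\<tau> k..<\<tau> (Suc k)} \<Longrightarrow>
        0 \<le> \<pi> (\<tau> k) \<omega> + h1 (\<tau> k) \<omega> \<Longrightarrow> 0 \<le> \<pi> (\<tau> k) \<omega> + h2 (\<tau> k) \<omega> \<Longrightarrow> \<omega> \<in> space M \<Longrightarrow>
        \<zeta>1 t \<omega> = (if d then running_max (?p \<omega>) (\<lambda>s. X s \<omega> - ?q \<omega>) (\<tau> k) t else ?p \<omega>)"
      by (rule extend[where d = d]) (rule that; assumption)
    obtain \<eta>1 \<eta>2 where "solution \<eta>1 \<eta>2" and agree: "\<And>t \<omega>. t < \<tau> (Suc k) \<Longrightarrow> \<eta>1 t \<omega> = \<zeta>1 t \<omega>"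
      using extend_to_horizon[OF _ \<zeta>] k by auto
    with unique have "AE \<omega> in M. \<forall>t\<in>{0..<T}. \<xi>1 t \<omega> = \<eta>1 t \<omega>"
      by (auto simp: same_on_def)
    with both AE_space show ?thesis
    proof eventually_elim
      case (elim \<omega>)
      then have "0 \<le> \<pi> (\<tau> k) \<omega> + h1 (\<tau> k) \<omega>" "0 \<le> \<pi> (\<tau> k) \<omega> + h2 (\<tau> k) \<omega>"
        using \<tau>_bounds[OF k] by auto
      then show ?case
        using on agree elim \<tau>_bounds[OF k] by auto
    qed
  qed
  have "AE \<omega> in M. \<forall>t\<in>{\<tau> k..<\<tau> (Suc k)}. X t \<omega> \<le> ?p \<omega> + ?q \<omega>"
    using forced[of True] forced[of False] AE_space
  proof eventually_elim
    case (elim \<omega>)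
    show ?case
    proof
      fix t assume t: "t \<in> {\<tau> k..<\<tau> (Suc k)}"
      have p: "0 \<le> ?p \<omega>"
        by (intro left_value_nonneg capacity_pathD \<xi> elim)
      have "continuous_on {\<tau> k..t} (\<lambda>s. X s \<omega>)"
        by (rule continuous_on_subset[OF X_cont[OF elim(3)]]) (use t \<tau>_bounds[OF k] in auto)
      then have "continuous_on {\<tau> k..t} (\<lambda>s. X s \<omega> - ?q \<omega>)"
        by (intro continuous_intros)
      from running_max_upper(2)[OF p _ this, of t] show "X t \<omega> \<le> ?p \<omega> + ?q \<omega>"
        using t elim(1,2) by auto
    qed
  qed
  with short show False by contradiction
qed

end

section \<open>The recursive characterization\<close>

theorem theorem6p3:
  fixes M :: "'a measure" and F :: "real \<Rightarrow> 'a measure"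
    and B X b \<sigma> \<pi> h1 h2 :: "real \<Rightarrow> 'a \<Rightarrow> real"
    and x T :: real and n :: nat and \<tau> :: "nat \<Rightarrow> real"
  assumes "prob_space M" and "usual_conditions M F" and "brownian_motion M F B"
    and "0 < T" and "0 < x"
    and "measurable_adapted M F T b" and "measurable_adapted M F T \<sigma>"
    and "measurable_adapted M F T \<pi>" and "measurable_adapted M F T h1"
    and "measurable_adapted M F T h2"
    and "mean_field_sde M F B T b \<sigma> x X"
    and "\<forall>t\<in>{0..T}. \<forall>\<omega>\<in>space M. 0 < \<pi> t \<omega> \<and> h1 t \<omega> < 0 \<and> h2 t \<omega> < 0"
    and "\<tau> 0 = 0" and "\<tau> n = T" and "\<forall>k<n. \<tau> k < \<tau> (Suc k)"
    and "\<forall>k<n. AE \<omega> in M.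
      ((\<forall>t\<in>{\<tau> k..<\<tau> (Suc k)}. \<pi> t \<omega> + h1 t \<omega> < 0) \<or>
       (\<forall>t\<in>{\<tau> k..<\<tau> (Suc k)}. 0 \<le> \<pi> t \<omega> + h1 t \<omega>)) \<and>
      ((\<forall>t\<in>{\<tau> k..<\<tau> (Suc k)}. \<pi> t \<omega> + h2 t \<omega> < 0) \<or>
       (\<forall>t\<in>{\<tau> k..<\<tau> (Suc k)}. 0 \<le> \<pi> t \<omega> + h2 t \<omega>))"
  shows "(\<forall>\<xi>1\<in>admissible M F. \<forall>\<xi>2\<in>admissible M F.
      follows recursion_rule M n \<tau> \<pi> h1 h2 X \<xi>1 \<xi>2 \<longrightarrow>
      skorohod_solution M F T \<pi> h1 h2 X \<xi>1 \<xi>2) \<and>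
    (\<forall>\<xi>1\<in>admissible M F. \<forall>\<xi>2\<in>admissible M F.
      skorohod_solution M F T \<pi> h1 h2 X \<xi>1 \<xi>2 \<longleftrightarrow>
      follows floored_recursion_rule M n \<tau> \<pi> h1 h2 X \<xi>1 \<xi>2) \<and>
    (\<exists>\<xi>1 \<xi>2. skorohod_solution M F T \<pi> h1 h2 X \<xi>1 \<xi>2) \<and>
    (\<forall>k<n. \<forall>\<xi>1 \<xi>2.
      (AE \<omega> in M. \<forall>t\<in>{\<tau> k..<\<tau> (Suc k)}. 0 \<le> \<pi> t \<omega> + h1 t \<omega> \<and> 0 \<le> \<pi> t \<omega> + h2 t \<omega>) \<and>
      skorohod_solution M F T \<pi> h1 h2 X \<xi>1 \<xi>2 \<and>
      (k = 0 \<or> \<not> (AE \<omega> in M. \<forall>t\<in>{\<tau> k..<\<tau> (Suc k)}.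
         X t \<omega> \<le> left_value (\<lambda>s. \<xi>1 s \<omega>) (\<tau> k) + left_value (\<lambda>s. \<xi>2 s \<omega>) (\<tau> k))) \<longrightarrow>
      (\<exists>\<eta>1 \<eta>2. skorohod_solution M F T \<pi> h1 h2 X \<eta>1 \<eta>2 \<and>
         \<not> (same_on M T \<xi>1 \<eta>1 \<and> same_on M T \<xi>2 \<eta>2) \<and>
         ((\<forall>\<zeta>1 \<zeta>2. skorohod_solution M F T \<pi> h1 h2 X \<zeta>1 \<zeta>2 \<longrightarrow>
              game_equilibrium M F T \<pi> h1 h2 X \<zeta>1 \<zeta>2) \<longrightarrow>
          game_equilibrium M F T \<pi> h1 h2 X \<xi>1 \<xi>2 \<and>
          game_equilibrium M F T \<pi> h1 h2 X \<eta>1 \<eta>2)))"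
proof -
  interpret capacity_game M F T \<pi> h1 h2 X n \<tau>
  proof (rule capacity_game.intro)
    show "AE \<omega> in M. \<forall>k<n.
      ((\<forall>t\<in>{\<tau> k..<\<tau> (Suc k)}. \<pi> t \<omega> + h1 t \<omega> < 0) \<or>
       (\<forall>t\<in>{\<tau> k..<\<tau> (Suc k)}. 0 \<le> \<pi> t \<omega> + h1 t \<omega>)) \<and>
      ((\<forall>t\<in>{\<tau> k..<\<tau> (Suc k)}. \<pi> t \<omega> + h2 t \<omega> < 0) \<or>
       (\<forall>t\<in>{\<tau> k..<\<tau> (Suc k)}. 0 \<le> \<pi> t \<omega> + h2 t \<omega>))"
      unfolding AE_all_countable
    proof
      fix k
      show "AE \<omega> in M. k < n \<longrightarrow>
        ((\<forall>t\<in>{\<tau> k..<\<tau> (Suc k)}. \<pi> t \<omega> + h1 t \<omega> < 0) \<or>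
         (\<forall>t\<in>{\<tau> k..<\<tau> (Suc k)}. 0 \<le> \<pi> t \<omega> + h1 t \<omega>)) \<and>
        ((\<forall>t\<in>{\<tau> k..<\<tau> (Suc k)}. \<pi> t \<omega> + h2 t \<omega> < 0) \<or>
         (\<forall>t\<in>{\<tau> k..<\<tau> (Suc k)}. 0 \<le> \<pi> t \<omega> + h2 t \<omega>))"
      proof (cases "k < n")
        case True
        from assms(16)[rule_format, OF this] show ?thesis by eventually_elim blast
      qed simp
    qed
  qed (use assms(2,8-11,13-15) in \<open>simp_all add: usual_conditions_def measurable_adapted_def mean_field_sde_def\<close>)
  \<comment> \<open>No capacity is installed before time 0, whereas the demand \<open>X(0) = x\<close> is positive.\<close>
  have shortage: "\<not> (AE \<omega> in M. \<forall>t\<in>{\<tau> 0..<\<tau> (Suc 0)}.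
      X t \<omega> \<le> left_value (\<lambda>s. \<xi>1 s \<omega>) (\<tau> 0) + left_value (\<lambda>s. \<xi>2 s \<omega>) (\<tau> 0))"
    if "0 < n" "solution \<xi>1 \<xi>2" for \<xi>1 \<xi>2
  proof
    assume enough: "AE \<omega> in M. \<forall>t\<in>{\<tau> 0..<\<tau> (Suc 0)}.
      X t \<omega> \<le> left_value (\<lambda>s. \<xi>1 s \<omega>) (\<tau> 0) + left_value (\<lambda>s. \<xi>2 s \<omega>) (\<tau> 0)"
    have \<xi>: "\<xi>1 \<in> admissible M F" "\<xi>2 \<in> admissible M F"
      using that(2) by (auto simp: skorohod_solution_def)
    have "AE \<omega> in M. X 0 \<omega> = x" using assms(11) by (simp add: mean_field_sde_def)
    with enough AE_space have "AE \<omega> in M. False"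
    proof eventually_elim
      case (elim \<omega>)
      have "X 0 \<omega> \<le> left_value (\<lambda>s. \<xi>1 s \<omega>) 0 + left_value (\<lambda>s. \<xi>2 s \<omega>) 0"
        using elim(1) \<tau>_bounds(2)[OF that(1)] \<tau>(1) by auto
      then show False
        using elim(2,3) \<open>0 < x\<close> by (simp add: left_value_0 capacity_pathD \<xi>)
    qed
    then show False
      using prob_space.AE_False[OF assms(1)] by simp
  qed
  show ?thesis
  proof (intro conjI ballI allI impI)
    fix \<xi>1 \<xi>2 assume \<xi>: "\<xi>1 \<in> admissible M F" "\<xi>2 \<in> admissible M F"
    show "solution \<xi>1 \<xi>2 \<longleftrightarrow> floored_until n \<xi>1 \<xi>2"
      by (rule solution_iff_floored[OF \<xi>])
    show "solution \<xi>1 \<xi>2" if "follows recursion_rule M n \<tau> \<pi> h1 h2 X \<xi>1 \<xi>2"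
      using recursion_imp_floored[OF \<xi> that] solution_iff_floored[OF \<xi>] by simp
  next
    show "\<exists>\<xi>1 \<xi>2. solution \<xi>1 \<xi>2" by (rule solution_exists)
  next
    fix k \<xi>1 \<xi>2
    assume k: "k < n"
      and *: "(AE \<omega> in M. \<forall>t\<in>{\<tau> k..<\<tau> (Suc k)}. 0 \<le> \<pi> t \<omega> + h1 t \<omega> \<and> 0 \<le> \<pi> t \<omega> + h2 t \<omega>) \<and>
        solution \<xi>1 \<xi>2 \<and>
        (k = 0 \<or> \<not> (AE \<omega> in M. \<forall>t\<in>{\<tau> k..<\<tau> (Suc k)}.
          X t \<omega> \<le> left_value (\<lambda>s. \<xi>1 s \<omega>) (\<tau> k) + left_value (\<lambda>s. \<xi>2 s \<omega>) (\<tau> k)))"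
    then have "\<not> (AE \<omega> in M. \<forall>t\<in>{\<tau> k..<\<tau> (Suc k)}.
          X t \<omega> \<le> left_value (\<lambda>s. \<xi>1 s \<omega>) (\<tau> k) + left_value (\<lambda>s. \<xi>2 s \<omega>) (\<tau> k))"
      using shortage by blast
    with k * obtain \<eta>1 \<eta>2 where "solution \<eta>1 \<eta>2" "\<not> same_on M T \<xi>1 \<eta>1"
      using another_solution by blast
    with * show "\<exists>\<eta>1 \<eta>2. solution \<eta>1 \<eta>2 \<and>
         \<not> (same_on M T \<xi>1 \<eta>1 \<and> same_on M T \<xi>2 \<eta>2) \<and>
         ((\<forall>\<zeta>1 \<zeta>2. solution \<zeta>1 \<zeta>2 \<longrightarrow> game_equilibrium M F T \<pi> h1 h2 X \<zeta>1 \<zeta>2) \<longrightarrow>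
          game_equilibrium M F T \<pi> h1 h2 X \<xi>1 \<xi>2 \<and> game_equilibrium M F T \<pi> h1 h2 X \<eta>1 \<eta>2)"
      by blast
  qed
qed

end
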